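(* Let $n\ge 1$, let $k$ be a field, $S=k[x_1,\ldots,x_n]$, and let $M$ be a monomial ideal of $S$. Let $L=\{l : l=\operatorname{lcm}(D)\text{ for some } D\in\mathscr{D}_M\}$ and, for every $j\ge 0$, let $L_j=\{l\in L : \deg l=j\}$. Then (i) $\operatorname{b}_n(S/M)=\# L$; (ii) $\operatorname{b}_{n,j}(S/M)=\# L_j$ for every $j\ge 0$.
   Context: $\operatorname{b}_i(S/M)$ is the $i$-th (total) Betti number of $S/M$ (the rank of the $i$-th free module of a minimal free resolution of $S/M$), and $\operatorname{b}_{i,j}(S/M)$ is the graded Betti number in homological degree $i$ and internal degree $j$ (the number of basis elements of total degree $j$ in the $i$-th free module of a minimal graded free resolution). $\deg$ of a monomial is its total degree. Let $G$ be the minimal generating set (of monomials) of $M$. For a set $L'$ of monomials, $m\in L'$ is dominant (in $L'$) if there is a variable $x$ such that for all $m'\in L'\setminus\{m\}$ the exponent of $x$ in $m$ is strictly larger than that in $m'$; $L'$ is a dominant set if each of its elements is dominant in $L'$. For monomials $l=x_1^{\alpha_1}\cdots x_n^{\alpha_n}$, $l'=x_1^{\beta_1}\cdots x_n^{\beta_n}$, $l$ strongly divides $l'$ if $\alpha_i<\beta_i$ whenever $\alpha_i\neq 0$. Finally, $\mathscr{D}_M=\{D\subseteq G : D$ is a dominant set of cardinality $n$ such that no element of $G$ strongly divides $\operatorname{lcm}(D)\}$. *)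

theory Defs
  imports
    "HOL-Library.Cardinality"
    "HOL-Library.Poly_Mapping"
    "Jordan_Normal_Form.Matrix_Kernel"
begin

section \<open>Polynomials and monomials\<close>

text \<open>
  The variables are the elements of a finite type \<open>'n\<close>, so their number is \<open>CARD('n) \<ge> 1\<close>.
  A monomial is represented by its exponent vector.
\<close>

type_synonym 'n mon = "'n \<Rightarrow>\<^sub>0 nat"
type_synonym ('n, 'k) mpol = "'n mon \<Rightarrow>\<^sub>0 'k"

definition monom_poly :: "'n mon \<Rightarrow> ('n, 'k::field) mpol" where
  "monom_poly t = Poly_Mapping.single t 1"

definition mdeg :: "'n::finite mon \<Rightarrow> nat" where
  "mdeg t = (\<Sum>x\<in>UNIV. Poly_Mapping.lookup t x)"

text \<open>
  Degrees are integers; the zero polynomial is homogeneous of every degree, and it is the only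
  one that is homogeneous of negative degree.
\<close>

definition homogeneous :: "('n::finite, 'k::field) mpol \<Rightarrow> int \<Rightarrow> bool" where
  "homogeneous p j \<longleftrightarrow> (\<forall>t\<in>Poly_Mapping.keys p. int (mdeg t) = j)"

definition ideal_gen :: "('n, 'k::field) mpol set \<Rightarrow> ('n, 'k) mpol set" where
  "ideal_gen B = Modules.module.span (*) B"

definition monomial_ideal :: "('n, 'k::field) mpol set \<Rightarrow> bool" where
  "monomial_ideal M \<longleftrightarrow> (\<exists>A. M = ideal_gen (monom_poly ` A))"

definition min_gens :: "('n, 'k::field) mpol set \<Rightarrow> 'n mon set" where
  "min_gens M = (THE G. ideal_gen (monom_poly ` G) = M \<and>
     (\<forall>G'. G' \<subset> G \<longrightarrow> ideal_gen (monom_poly ` G') \<noteq> M))"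


section \<open>Minimal graded free resolutions and Betti numbers\<close>

text \<open>
  A graded free module of finite rank is given by the list \<open>ds\<close> of the degrees of its basis
  elements, i.e. it is the direct sum of the \<open>S(- ds ! a)\<close>; its elements are the vectors of
  dimension \<open>length ds\<close>. A homomorphism of degree 0 between two such modules is multiplication
  by a matrix whose entry at \<open>(a, b)\<close> is homogeneous of degree \<open>ds' ! b - ds ! a\<close>.
\<close>

definition graded_map :: "int list \<Rightarrow> int list \<Rightarrow> ('n::finite, 'k::field) mpol mat \<Rightarrow> bool" where
  "graded_map ds ds' A \<longleftrightarrow> A \<in> carrier_mat (length ds) (length ds') \<and>
     (\<forall>a<length ds. \<forall>b<length ds'. homogeneous (A $$ (a, b)) (ds' ! b - ds ! a))"

definition mat_image :: "'a::comm_ring_1 mat \<Rightarrow> 'a vec set" where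
  "mat_image A = {A *\<^sub>v v | v. v \<in> carrier_vec (dim_col A)}"

text \<open>
  A minimal graded free resolution
  \<open>\<dots> \<rightarrow> F\<^sub>2 \<rightarrow> F\<^sub>1 \<rightarrow> F\<^sub>0 \<rightarrow> S/M \<rightarrow> 0\<close>: the list \<open>degs i\<close> contains the degrees of the basis
  elements of \<open>F\<^sub>i\<close>, the matrix \<open>d i\<close> is the differential from \<open>F\<^bsub>i+1\<^esub>\<close> to \<open>F\<^sub>i\<close>, and
  \<open>e\<close> contains representatives in \<open>S\<close> of the images in \<open>S/M\<close> of the basis elements of \<open>F\<^sub>0\<close>,
  so that \<open>v \<in> F\<^sub>0\<close> is mapped to the class of \<open>e \<bullet> v\<close> modulo \<open>M\<close>. Minimality, i.e.
  \<open>d i (F\<^bsub>i+1\<^esub>) \<subseteq> (x\<^sub>1, \<dots>, x\<^sub>n) F\<^sub>i\<close>, says that the entries of \<open>d i\<close> have constant term 0.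
\<close>

definition minimal_graded_free_resolution ::
    "('n::finite, 'k::field) mpol set \<Rightarrow> (nat \<Rightarrow> int list) \<Rightarrow> ('n, 'k) mpol vec \<Rightarrow>
     (nat \<Rightarrow> ('n, 'k) mpol mat) \<Rightarrow> bool" where
  "minimal_graded_free_resolution M degs e d \<longleftrightarrow>
     e \<in> carrier_vec (length (degs 0)) \<and>
     (\<forall>b<length (degs 0). homogeneous (e $ b) (degs 0 ! b)) \<and>
     (\<forall>i. graded_map (degs i) (degs (Suc i)) (d i)) \<and>
     (\<forall>f. \<exists>v\<in>carrier_vec (length (degs 0)). f - e \<bullet> v \<in> M) \<and>
     {v \<in> carrier_vec (length (degs 0)). e \<bullet> v \<in> M} = mat_image (d 0) \<and>
     (\<forall>i. mat_kernel (d i) = mat_image (d (Suc i))) \<and>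
     (\<forall>i. \<forall>a<length (degs i). \<forall>b<length (degs (Suc i)).
        Poly_Mapping.lookup (d i $$ (a, b)) 0 = 0)"

definition betti :: "nat \<Rightarrow> ('n::finite, 'k::field) mpol set \<Rightarrow> nat" where
  "betti i M = (THE b. \<exists>degs e d. minimal_graded_free_resolution M degs e d \<and>
     b = length (degs i))"

definition graded_betti :: "nat \<Rightarrow> int \<Rightarrow> ('n::finite, 'k::field) mpol set \<Rightarrow> nat" where
  "graded_betti i j M = (THE b. \<exists>degs e d. minimal_graded_free_resolution M degs e d \<and>
     b = count_list (degs i) j)"


section \<open>Dominant sets\<close>

definition dominant_in :: "'n mon \<Rightarrow> 'n mon set \<Rightarrow> bool" where
  "dominant_in m L \<longleftrightarrow> m \<in> L \<and>
     (\<exists>x. \<forall>m'\<in>L - {m}. Poly_Mapping.lookup m' x < Poly_Mapping.lookup m x)"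

definition dominant_set :: "'n mon set \<Rightarrow> bool" where
  "dominant_set L \<longleftrightarrow> (\<forall>m\<in>L. dominant_in m L)"

definition strongly_divides :: "'n mon \<Rightarrow> 'n mon \<Rightarrow> bool" where
  "strongly_divides l l' \<longleftrightarrow>
     (\<forall>x. Poly_Mapping.lookup l x \<noteq> 0 \<longrightarrow> Poly_Mapping.lookup l x < Poly_Mapping.lookup l' x)"

text \<open>Inserting 0 only serves to make the lcm of the empty set equal to 1.\<close>

definition mon_lcm :: "'n::finite mon set \<Rightarrow> 'n mon" where
  "mon_lcm D = Poly_Mapping.Abs_poly_mapping
     (\<lambda>x. Max (insert 0 ((\<lambda>m. Poly_Mapping.lookup m x) ` D)))"

definition dominant_family :: "('n::finite, 'k::field) mpol set \<Rightarrow> 'n mon set set" where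
  "dominant_family M = {D. D \<subseteq> min_gens M \<and> dominant_set D \<and> card D = CARD('n) \<and>
     \<not> (\<exists>g\<in>min_gens M. strongly_divides g (mon_lcm D))}"

definition lcm_set :: "('n::finite, 'k::field) mpol set \<Rightarrow> 'n mon set" where
  "lcm_set M = {l. \<exists>D\<in>dominant_family M. l = mon_lcm D}"

end

theory Submission
  imports Defs "HOL-Library.Function_Algebras"
begin

text \<open>
  Both Betti numbers count the same thing: the monomials \<open>t \<notin> M\<close> such that \<open>x t \<in> M\<close> for every
  variable \<open>x\<close>. Their classes form a basis of the socle \<open>(M : (x\<^sub>1, \<dots>, x\<^sub>n)) / M\<close> of \<open>S/M\<close>, and they
  are called socle monomials below.

  On the combinatorial side, \<open>t \<mapsto> t x\<^sub>1 \<cdots> x\<^sub>n\<close> maps the socle monomials bijectively onto the lcms of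
  the members of \<open>\<D>\<^sub>M\<close>. A generator strongly divides \<open>t x\<^sub>1 \<cdots> x\<^sub>n\<close> iff it divides \<open>t\<close>, so the
  condition on strong division says \<open>t \<notin> M\<close>. A dominant set of \<open>n\<close> generators has one
  generator per variable \<open>x\<close> that attains the exponent of \<open>x\<close> in the lcm and stays below the lcm in all
  other variables; such a generator is exactly a witness of \<open>x t \<in> M\<close>. See
  \<open>lcm_of_socle_monomial\<close> and \<open>socle_monomial_of_lcm\<close>.

  On the homological side, let \<open>F\<close> be a minimal graded free resolution of \<open>S/M\<close> and let
  \<open>C\<^sub>r = F / (x\<^sub>1, \<dots>, x\<^sub>r) F\<close>. Since \<open>x\<^bsub>r+1\<^esub>\<close> is regular on \<open>C\<^sub>r\<close>, there is a short exact sequence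
  \<open>0 \<rightarrow> C\<^sub>r \<rightarrow> C\<^sub>r \<rightarrow> C\<^bsub>r+1\<^esub> \<rightarrow> 0\<close> whose first map is multiplication by \<open>x\<^bsub>r+1\<^esub>\<close>. Its long exact
  sequence shows by induction on \<open>r\<close> that \<open>H\<^sub>i(C\<^sub>r) = 0\<close> for \<open>i > r\<close> (\<open>acyclic_above\<close>) and that
  \<open>H\<^bsub>r+1\<^esub>(C\<^bsub>r+1\<^esub>)\<close> is the kernel of \<open>x\<^bsub>r+1\<^esub>\<close> on \<open>H\<^sub>r(C\<^sub>r)\<close>. Starting from \<open>H\<^sub>0(C\<^sub>0) = S/M\<close> this gives
  \<open>H\<^sub>r(C\<^sub>r) = (M : (x\<^sub>1, \<dots>, x\<^sub>r)) / M\<close>, with a degree shift by \<open>r\<close>. For \<open>r = n\<close> the differentials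
  of \<open>C\<^sub>n\<close> vanish by minimality, so \<open>H\<^sub>n(C\<^sub>n)\<close> is \<open>F\<^sub>n / (x\<^sub>1, \<dots>, x\<^sub>n) F\<^sub>n\<close>, whose dimension in
  degree \<open>j\<close> is the number of basis elements of \<open>F\<^sub>n\<close> of degree \<open>j\<close>. This avoids the
  Koszul complex and its signs. The isomorphism is handled as a linear relation between \<open>F\<^sub>r\<close> and
  \<open>S\<close>, the composite of the connecting homomorphisms, called \<open>zigzag\<close>; the count is \<open>top_degrees\<close>.

  This determines the ranks in every minimal resolution. The Betti numbers being defined by a
  definite description, a minimal resolution must also be shown to exist. It is built with a
  grading by monomials: in multidegree \<open>t\<close> a free module is a finite-dimensional vector space, a
  differential is a scalar matrix that is independent of \<open>t\<close>, and the kernel changes with \<open>t\<close> at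
  finitely many places only. Hence linear algebra yields a finite set of multihomogeneous
  generators of each kernel, and a set of least size makes the resolution minimal
  (\<open>exists_min_generates\<close>, \<open>exists_resolution_of_proper\<close>). Dickson's lemma starts the
  construction by making the set of minimal generators of \<open>M\<close> finite.
\<close>

section \<open>Monomials and monomial ideals\<close>

text \<open>
  Divisibility of monomials. The order instance of \<open>poly_mapping\<close> is lexicographic and cannot express it.
\<close>
definition mon_le :: "'n mon \<Rightarrow> 'n mon \<Rightarrow> bool" where
  "mon_le s t \<longleftrightarrow> (\<forall>x. Poly_Mapping.lookup s x \<le> Poly_Mapping.lookup t x)"

definition expo :: "'n \<Rightarrow> 'n mon" where
  "expo x = Poly_Mapping.single x 1"

abbreviation var :: "'n \<Rightarrow> ('n, 'k::field) mpol" where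
  "var x \<equiv> monom_poly (expo x)"

lemma lookup_expo [simp]: "Poly_Mapping.lookup (expo x) y = (if x = y then 1 else 0)"
  by (simp add: expo_def lookup_single when_def)

lemma mon_le_refl [simp]: "mon_le t t"
  by (simp add: mon_le_def)

lemma mon_le_trans: "mon_le s t \<Longrightarrow> mon_le t u \<Longrightarrow> mon_le s u"
  unfolding mon_le_def using order_trans by blast

lemma mon_le_zero [simp]: "mon_le 0 t"
  by (simp add: mon_le_def)

lemma mon_le_add_right [simp]: "mon_le s (s + t)" "mon_le s (t + s)"
  by (simp_all add: mon_le_def lookup_add)

lemma mon_le_add_diff: "mon_le s t \<Longrightarrow> s + (t - s) = t"
  by (rule poly_mapping_eqI) (simp add: mon_le_def lookup_add lookup_minus)

lemma mon_le_diff_add: "mon_le s t \<Longrightarrow> t - s + s = t"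
  using mon_le_add_diff[of s t] by (simp add: add.commute)

lemma mon_le_iff_ex: "mon_le s t \<longleftrightarrow> (\<exists>u. t = s + u)"
  using mon_le_add_diff mon_le_add_right(1) by metis

lemma mdeg_add: "mdeg (s + t) = mdeg s + mdeg t"
  by (simp add: mdeg_def lookup_add sum.distrib)

lemma mdeg_zero [simp]: "mdeg 0 = 0"
  by (simp add: mdeg_def)

lemma mdeg_expo [simp]: "mdeg (expo x) = 1"
  by (simp add: mdeg_def)

lemma mdeg_diff: "mon_le s t \<Longrightarrow> int (mdeg (t - s)) = int (mdeg t) - int (mdeg s)"
  using mdeg_add[of s "t - s"] by (simp add: mon_le_add_diff)

lemma mdeg_eq_imp_eq:
  assumes "mon_le s t" "mdeg t \<le> mdeg s"
  shows "s = t"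
proof (rule poly_mapping_eqI, rule ccontr)
  fix x assume "Poly_Mapping.lookup s x \<noteq> Poly_Mapping.lookup t x"
  then have "Poly_Mapping.lookup s x < Poly_Mapping.lookup t x"
    using assms(1) by (simp add: mon_le_def order_less_le)
  then have "mdeg s < mdeg t"
    unfolding mdeg_def using assms(1) by (intro sum_strict_mono_ex1) (auto simp: mon_le_def)
  with assms(2) show False by simp
qed

lemma mon_le_expo: "mon_le (expo x) t \<longleftrightarrow> Poly_Mapping.lookup t x \<noteq> 0"
  by (auto simp: mon_le_def)

lemma lookup_single_mult:
  fixes p :: "('n, 'k::field) mpol"
  shows "Poly_Mapping.lookup (Poly_Mapping.single s c * p) t =
    (if mon_le s t then c * Poly_Mapping.lookup p (t - s) else 0)"
proof -
  have eq: "t = s + q \<longleftrightarrow> mon_le s t \<and> q = t - s" for q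
    by (metis add_diff_cancel_left' mon_le_add_diff mon_le_add_right(1))
  have "Poly_Mapping.lookup (Poly_Mapping.single s c * p) t =
      Sum_any (\<lambda>l. (c * Sum_any (\<lambda>q. Poly_Mapping.lookup p q when t = l + q)) when l = s)"
    unfolding lookup_mult by (rule Sum_any.cong) (auto simp: lookup_single when_def)
  also have "\<dots> = c * Sum_any (\<lambda>q. Poly_Mapping.lookup p q when t = s + q)"
    by simp
  also have "Sum_any (\<lambda>q. Poly_Mapping.lookup p q when t = s + q) =
      Sum_any (\<lambda>q. (if mon_le s t then Poly_Mapping.lookup p q else 0) when q = t - s)"
    by (rule Sum_any.cong) (auto simp: when_def eq)
  finally show ?thesis by simp
qed

lemma keys_mult_obtain:
  assumes "Poly_Mapping.lookup (p * q) t \<noteq> 0"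
  obtains a b where "t = a + b" "Poly_Mapping.lookup p a \<noteq> 0" "Poly_Mapping.lookup q b \<noteq> 0"
  using keys_mult[of p q] assms by (auto simp: in_keys_iff)

lemma lookup_Abs_finite:
  fixes f :: "'n::finite \<Rightarrow> 'b::zero"
  shows "Poly_Mapping.lookup (Poly_Mapping.Abs_poly_mapping f) = f"
  by (rule lookup_Abs_poly_mapping) simp

lemma poly_eq_sum_monomials:
  "p = (\<Sum>t\<in>Poly_Mapping.keys p. Poly_Mapping.single t (Poly_Mapping.lookup p t))"
  by (rule poly_mapping_eqI)
     (auto simp: lookup_sum lookup_single when_def in_keys_iff sum.delta)

context
begin

interpretation ring_module: module "(*) :: 'a::comm_ring_1 \<Rightarrow> 'a \<Rightarrow> 'a"
  by unfold_locales (simp_all add: algebra_simps)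

text \<open>
  Polynomials whose terms are all divisible by generators form an ideal, and each of their terms
  is a multiple of a generator. Membership in a monomial ideal is therefore a question about
  exponent vectors only.
\<close>
lemma ideal_gen_monomials:
  fixes A :: "'n mon set"
  shows "(p :: ('n, 'k::field) mpol) \<in> ideal_gen (monom_poly ` A) \<longleftrightarrow>
    (\<forall>t\<in>Poly_Mapping.keys p. \<exists>a\<in>A. mon_le a t)"
proof
  assume "p \<in> ideal_gen (monom_poly ` A)"
  then show "\<forall>t\<in>Poly_Mapping.keys p. \<exists>a\<in>A. mon_le a t"
    unfolding ideal_gen_def
  proof (induction rule: ring_module.span_induct_alt)
    case base
    show ?case by simp
  next
    case (step c x y)
    then obtain a where a: "a \<in> A" "x = monom_poly a" by auto
    have "\<exists>a\<in>A. mon_le a t" if t: "t \<in> Poly_Mapping.keys (c * x)" for t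
    proof -
      have "mon_le a t"
        using t a by (simp add: monom_poly_def mult.commute[of c] in_keys_iff lookup_single_mult
            split: if_splits)
      with a show ?thesis by blast
    qed
    then show ?case using step keys_add[of "c * x" y] by blast
  qed
next
  assume *: "\<forall>t\<in>Poly_Mapping.keys p. \<exists>a\<in>A. mon_le a t"
  have "Poly_Mapping.single t (Poly_Mapping.lookup p t) \<in> ideal_gen (monom_poly ` A)"
    if "t \<in> Poly_Mapping.keys p" for t
  proof -
    from * that obtain a where a: "a \<in> A" "mon_le a t" by blast
    have "Poly_Mapping.single t (Poly_Mapping.lookup p t) =
        Poly_Mapping.single (t - a) (Poly_Mapping.lookup p t) * monom_poly a"
      by (simp add: monom_poly_def mult_single mon_le_diff_add a)
    then show ?thesis
      unfolding ideal_gen_def using a by (simp add: ring_module.span_scale ring_module.span_base)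
  qed
  then have "(\<Sum>t\<in>Poly_Mapping.keys p. Poly_Mapping.single t (Poly_Mapping.lookup p t))
      \<in> ideal_gen (monom_poly ` A)"
    unfolding ideal_gen_def by (rule ring_module.span_sum)
  then show "p \<in> ideal_gen (monom_poly ` A)"
    using poly_eq_sum_monomials[of p] by metis
qed

end

definition mons :: "('n, 'k::field) mpol set \<Rightarrow> 'n mon set" where
  "mons M = {t. monom_poly t \<in> M}"

lemma mons_ideal_gen:
  "mons (ideal_gen (monom_poly ` A) :: ('n, 'k::field) mpol set) = {t. \<exists>a\<in>A. mon_le a t}"
  by (auto simp: mons_def ideal_gen_monomials) (auto simp: monom_poly_def)

lemma ideal_gen_monomials_eq_iff:
  "(ideal_gen (monom_poly ` A) :: ('n, 'k::field) mpol set) = ideal_gen (monom_poly ` B) \<longleftrightarrow>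
    {t. \<exists>a\<in>A. mon_le a t} = {t. \<exists>a\<in>B. mon_le a t}"
  (is "?I = ?J \<longleftrightarrow> ?U = ?V")
proof
  assume "?I = ?J"
  then have "mons ?I = mons ?J" by simp
  then show "?U = ?V" by (simp only: mons_ideal_gen)
next
  assume eq: "?U = ?V"
  then have "(\<exists>a\<in>A. mon_le a t) \<longleftrightarrow> (\<exists>a\<in>B. mon_le a t)" for t by blast
  then show "?I = ?J" by (simp add: set_eq_iff ideal_gen_monomials)
qed

text \<open>
  The monomials whose classes form a basis of the socle of \<open>S/M\<close>.
\<close>
definition socle_mons :: "('n, 'k::field) mpol set \<Rightarrow> 'n mon set" where
  "socle_mons M = {t. t \<notin> mons M \<and> (\<forall>x. t + expo x \<in> mons M)}"

definition ones :: "'n::finite mon" where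
  "ones = Poly_Mapping.Abs_poly_mapping (\<lambda>_. 1)"

lemma lookup_ones [simp]: "Poly_Mapping.lookup ones x = 1"
  by (simp add: ones_def lookup_Abs_finite)

lemma mdeg_ones: "mdeg (ones :: 'n mon) = CARD('n::finite)"
  by (simp add: mdeg_def)

text \<open>
  All exponents of \<open>l = t x\<^sub>1 \<cdots> x\<^sub>n\<close> are positive. An exponent 0 of \<open>g\<close> is thus strictly below that of
  \<open>l\<close> as well, so the case distinction in the definition of strong division disappears.
\<close>
lemma strongly_divides_add_ones: "strongly_divides g (t + ones) \<longleftrightarrow> mon_le g t"
proof -
  have "(a \<noteq> 0 \<longrightarrow> a < b + 1) \<longleftrightarrow> a \<le> b" for a b :: nat by auto
  then show ?thesis by (simp only: strongly_divides_def mon_le_def lookup_add lookup_ones)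
qed

lemma lookup_mon_lcm:
  fixes D :: "'n::finite mon set"
  shows "Poly_Mapping.lookup (mon_lcm D) x = Max (insert 0 ((\<lambda>m. Poly_Mapping.lookup m x) ` D))"
  by (simp add: mon_lcm_def lookup_Abs_finite)

context
  fixes M :: "('n::finite, 'k::field) mpol set"
  assumes M: "monomial_ideal M"
begin

lemma in_monomial_ideal_iff: "p \<in> M \<longleftrightarrow> (\<forall>t\<in>Poly_Mapping.keys p. t \<in> mons M)"
proof -
  from M obtain A where "M = ideal_gen (monom_poly ` A)"
    unfolding monomial_ideal_def by blast
  then show ?thesis by (simp add: mons_ideal_gen ideal_gen_monomials)
qed

lemma mons_upward: "s \<in> mons M \<Longrightarrow> mon_le s t \<Longrightarrow> t \<in> mons M"
proof -
  assume "s \<in> mons M" "mon_le s t"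
  moreover from M obtain A where "M = ideal_gen (monom_poly ` A)"
    unfolding monomial_ideal_def by blast
  ultimately show ?thesis by (auto simp: mons_ideal_gen intro: mon_le_trans)
qed

lemma ideal_zero [simp]: "0 \<in> M"
  by (simp add: in_monomial_ideal_iff)

lemma ideal_add: "p \<in> M \<Longrightarrow> q \<in> M \<Longrightarrow> p + q \<in> M"
  using keys_add[of p q] unfolding in_monomial_ideal_iff by blast

lemma ideal_mult: "p \<in> M \<Longrightarrow> q * p \<in> M"
  unfolding in_monomial_ideal_iff
proof
  fix t assume p: "\<forall>t\<in>Poly_Mapping.keys p. t \<in> mons M" and "t \<in> Poly_Mapping.keys (q * p)"
  then obtain a b where "t = a + b" "Poly_Mapping.lookup p b \<noteq> 0"
    using keys_mult_obtain by (metis in_keys_iff)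
  then show "t \<in> mons M"
    using p mons_upward mon_le_add_right(2) by (metis in_keys_iff)
qed

lemma ideal_diff: "p \<in> M \<Longrightarrow> q \<in> M \<Longrightarrow> p - q \<in> M"
  using ideal_add[of p "(- 1) * q"] ideal_mult[of q "- 1"] by simp

text \<open>
  Divisors have smaller total degree, so descending along divisibility terminates.
\<close>
lemma exists_minimal_monomial_below:
  assumes "t \<in> mons M"
  shows "\<exists>g. mon_le g t \<and> g \<in> mons M \<and> (\<forall>s\<in>mons M. mon_le s g \<longrightarrow> s = g)"
  using assms
proof (induction "mdeg t" arbitrary: t rule: less_induct)
  case less
  show ?case
  proof (cases "\<forall>s\<in>mons M. mon_le s t \<longrightarrow> s = t")
    case True
    with less.prems show ?thesis using mon_le_refl by blast
  next
    case False
    then obtain s where s: "s \<in> mons M" "mon_le s t" "s \<noteq> t" by blast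
    then have "mdeg s < mdeg t" using mdeg_eq_imp_eq not_le by blast
    from less.hyps[OF this s(1)] s(2) show ?thesis using mon_le_trans by blast
  qed
qed

text \<open>
  The divisibility-minimal monomials of \<open>M\<close> generate \<open>M\<close>, and every monomial generating set
  contains them, because a generator that divides a minimal monomial is equal to it. Hence they
  are the unique irredundant generating set.
\<close>
lemma min_gens_eq: "min_gens M = {g \<in> mons M. \<forall>s\<in>mons M. mon_le s g \<longrightarrow> s = g}" (is "_ = ?G")
proof -
  have gen_iff: "ideal_gen (monom_poly ` G) = M \<longleftrightarrow> {t. \<exists>a\<in>G. mon_le a t} = mons M" for G
  proof -
    from M obtain A where A: "M = ideal_gen (monom_poly ` A)"
      unfolding monomial_ideal_def by blast
    show ?thesis unfolding A ideal_gen_monomials_eq_iff mons_ideal_gen ..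
  qed
  have G: "{t. \<exists>a\<in>?G. mon_le a t} = mons M"
  proof (intro equalityI subsetI)
    fix t assume "t \<in> {t. \<exists>a\<in>?G. mon_le a t}"
    then show "t \<in> mons M" using mons_upward by auto
  next
    fix t assume "t \<in> mons M"
    then show "t \<in> {t. \<exists>a\<in>?G. mon_le a t}"
      using exists_minimal_monomial_below[of t] by auto
  qed
  have sub: "?G \<subseteq> G'" if "{t. \<exists>a\<in>G'. mon_le a t} = mons M" for G'
  proof
    fix g assume g: "g \<in> ?G"
    then have "g \<in> {t. \<exists>a\<in>G'. mon_le a t}" unfolding that by simp
    then obtain a where a: "a \<in> G'" "mon_le a g" by auto
    then have "a \<in> {t. \<exists>a\<in>G'. mon_le a t}" by (auto intro: bexI[of _ a])
    then have "a \<in> mons M" unfolding that .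
    with a g show "g \<in> G'" by auto
  qed
  show ?thesis unfolding min_gens_def gen_iff
  proof (rule the_equality)
    show "{t. \<exists>a\<in>?G. mon_le a t} = mons M \<and>
        (\<forall>G'. G' \<subset> ?G \<longrightarrow> {t. \<exists>a\<in>G'. mon_le a t} \<noteq> mons M)"
      using G sub by (metis (no_types, lifting) psubsetE)
  next
    fix G' assume G': "{t. \<exists>a\<in>G'. mon_le a t} = mons M \<and>
        (\<forall>G''. G'' \<subset> G' \<longrightarrow> {t. \<exists>a\<in>G''. mon_le a t} \<noteq> mons M)"
    then have "?G \<subseteq> G'" using sub[of G'] by simp
    moreover have "\<not> ?G \<subset> G'" using G' G by blast
    ultimately show "G' = ?G" by blast
  qed
qed

lemma min_gens_subset: "min_gens M \<subseteq> mons M"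
  by (auto simp: min_gens_eq)

lemma mons_iff_min_gens: "t \<in> mons M \<longleftrightarrow> (\<exists>g\<in>min_gens M. mon_le g t)"
  using exists_minimal_monomial_below[of t] mons_upward[of _ t] unfolding min_gens_eq by auto

text \<open>
  For each variable \<open>x\<close> choose a generator \<open>g x\<close> dividing \<open>x t\<close>. It does not divide \<open>t\<close>, so its
  exponent of \<open>x\<close> is exactly one larger than that of \<open>t\<close>, and its other exponents are at most those
  of \<open>t\<close>. So \<open>g x\<close> dominates in \<open>x\<close>, and the lcm of the chosen generators is \<open>t x\<^sub>1 \<cdots> x\<^sub>n\<close>.
\<close>
lemma lcm_of_socle_monomial:
  assumes "t \<in> socle_mons M"
  shows "t + ones \<in> lcm_set M"
proof -
  have t: "t \<notin> mons M" "\<And>x. t + expo x \<in> mons M"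
    using assms by (auto simp: socle_mons_def)
  then have "\<forall>x. \<exists>g\<in>min_gens M. mon_le g (t + expo x)"
    using mons_iff_min_gens by blast
  then obtain g where g: "\<And>x. g x \<in> min_gens M" "\<And>x. mon_le (g x) (t + expo x)" by metis
  have le: "Poly_Mapping.lookup (g x) y \<le> Poly_Mapping.lookup t y" if "y \<noteq> x" for x y
    using g(2)[of x] that by (auto simp: mon_le_def lookup_add lookup_single when_def split: if_splits)
  have nle: "\<not> mon_le (g x) t" for x
    using g(1) t(1) mons_iff_min_gens by blast
  have eq: "Poly_Mapping.lookup (g x) x = Poly_Mapping.lookup t x + 1" for x
  proof -
    have "Poly_Mapping.lookup (g x) x \<le> Poly_Mapping.lookup (t + expo x) x"
      using g(2)[of x] by (simp add: mon_le_def)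
    moreover have "\<not> Poly_Mapping.lookup (g x) x \<le> Poly_Mapping.lookup t x"
      using nle[of x] le[of _ x] by (metis mon_le_def)
    ultimately show ?thesis by (simp add: lookup_add)
  qed
  have inj: "inj g"
  proof (rule injI, rule ccontr)
    fix x y assume "g x = g y" "x \<noteq> y"
    then show False using le[of x y] eq[of x] eq[of y] by simp
  qed
  have "dominant_set (range g)"
    unfolding dominant_set_def
  proof
    fix m assume "m \<in> range g"
    then obtain x where m: "m = g x" by blast
    have "\<forall>m'\<in>range g - {m}. Poly_Mapping.lookup m' x < Poly_Mapping.lookup m x"
    proof
      fix m' assume "m' \<in> range g - {m}"
      then obtain y where "m' = g y" "y \<noteq> x" using m by blast
      then show "Poly_Mapping.lookup m' x < Poly_Mapping.lookup m x"
        using le[of x y] eq[of x] m by simp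
    qed
    then show "dominant_in m (range g)" unfolding dominant_in_def using \<open>m \<in> range g\<close> by blast
  qed
  moreover have lcm: "mon_lcm (range g) = t + ones"
  proof (rule poly_mapping_eqI)
    fix x
    have "Max (insert 0 ((\<lambda>m. Poly_Mapping.lookup m x) ` range g)) = Poly_Mapping.lookup t x + 1"
    proof (rule Max_eqI)
      show "finite (insert 0 ((\<lambda>m. Poly_Mapping.lookup m x) ` range g))" by simp
      show "Poly_Mapping.lookup t x + 1 \<in> insert 0 ((\<lambda>m. Poly_Mapping.lookup m x) ` range g)"
        using eq[of x] by (metis image_eqI insertI2 rangeI)
      fix k assume "k \<in> insert 0 ((\<lambda>m. Poly_Mapping.lookup m x) ` range g)"
      then consider "k = 0" | y where "k = Poly_Mapping.lookup (g y) x" by blast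
      then show "k \<le> Poly_Mapping.lookup t x + 1"
      proof cases
        case 2
        then show ?thesis using le[of x y] eq[of x] by (cases "x = y") auto
      qed simp
    qed
    then show "Poly_Mapping.lookup (mon_lcm (range g)) x = Poly_Mapping.lookup (t + ones) x"
      by (simp add: lookup_mon_lcm lookup_add)
  qed
  moreover have "card (range g) = CARD('n)" by (rule card_image[OF inj])
  moreover have "\<not> (\<exists>h\<in>min_gens M. strongly_divides h (mon_lcm (range g)))"
    using t(1) mons_iff_min_gens unfolding lcm strongly_divides_add_ones by blast
  ultimately have "range g \<in> dominant_family M"
    using g(1) by (auto simp: dominant_family_def)
  with lcm show ?thesis unfolding lcm_set_def by (auto intro!: bexI[of _ "range g"])
qed

text \<open>
  Distinct elements of a dominant set dominate in distinct variables. A dominant set with as many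
  elements as there are variables therefore has exactly one element dominating in each variable
  \<open>x\<close>. That element agrees with the lcm in \<open>x\<close> and is strictly smaller in all other variables, hence
  it divides \<open>x l / (x\<^sub>1 \<cdots> x\<^sub>n)\<close>.
\<close>
lemma socle_monomial_of_lcm:
  assumes "l \<in> lcm_set M"
  shows "\<exists>t\<in>socle_mons M. l = t + ones"
proof -
  from assms obtain D where D: "D \<subseteq> min_gens M" "dominant_set D" "card D = CARD('n)"
    "\<not> (\<exists>g\<in>min_gens M. strongly_divides g (mon_lcm D))" and l: "l = mon_lcm D"
    by (auto simp: lcm_set_def dominant_family_def)
  have fin: "finite D" using D(3) by (metis card_ge_0_finite finite_UNIV_card_ge_0 finite)
  from D(2) have "\<forall>m\<in>D. \<exists>x. \<forall>m'\<in>D - {m}. Poly_Mapping.lookup m' x < Poly_Mapping.lookup m x"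
    by (auto simp: dominant_set_def dominant_in_def)
  then obtain f where f: "\<And>m m'. m \<in> D \<Longrightarrow> m' \<in> D \<Longrightarrow> m' \<noteq> m \<Longrightarrow>
      Poly_Mapping.lookup m' (f m) < Poly_Mapping.lookup m (f m)" by (metis Diff_iff singletonD)
  have "inj_on f D"
    by (rule inj_onI) (metis f less_asym)
  then have surj: "f ` D = UNIV"
    using D(3) by (metis card_image card_subset_eq finite subset_UNIV)
  have le: "Poly_Mapping.lookup m x \<le> Poly_Mapping.lookup l x" if "m \<in> D" for m x
    unfolding l lookup_mon_lcm by (rule Max_ge) (use fin that in auto)
  have l_eq: "Poly_Mapping.lookup l (f m) = Poly_Mapping.lookup m (f m)" if "m \<in> D" for m
    unfolding l lookup_mon_lcm
  proof (rule Max_eqI)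
    show "finite (insert 0 ((\<lambda>k. Poly_Mapping.lookup k (f m)) ` D))" using fin by simp
    show "Poly_Mapping.lookup m (f m) \<in> insert 0 ((\<lambda>k. Poly_Mapping.lookup k (f m)) ` D)"
      using that by blast
    fix k assume "k \<in> insert 0 ((\<lambda>k. Poly_Mapping.lookup k (f m)) ` D)"
    then show "k \<le> Poly_Mapping.lookup m (f m)" using f[OF that] that by (auto intro: less_imp_le)
  qed
  (* An element that dominates with exponent 0 is the only element of D. Then there is one variable
     and the element is 1, which strongly divides every monomial. *)
  have pos: "Poly_Mapping.lookup l (f m) \<noteq> 0" if m: "m \<in> D" for m
  proof
    assume z: "Poly_Mapping.lookup l (f m) = 0"
    have "D = {m}"
    proof (rule ccontr)
      assume "D \<noteq> {m}"
      then obtain m' where "m' \<in> D" "m' \<noteq> m" using m by blast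
      with f[OF m] l_eq[OF m] z show False by fastforce
    qed
    then have "f ` D = {f m}" by simp
    with surj have "\<And>x. x = f m" by (metis UNIV_I singletonD)
    then have "\<And>x. Poly_Mapping.lookup m x = 0" using l_eq[OF m] z by metis
    then have "strongly_divides m (mon_lcm D)" by (simp add: strongly_divides_def)
    with D(1,4) m show False by blast
  qed
  define t where "t = l - ones"
  have l': "l = t + ones"
  proof (rule poly_mapping_eqI)
    fix x
    have "Poly_Mapping.lookup l x \<noteq> 0" using pos surj by (metis imageE UNIV_I)
    then show "Poly_Mapping.lookup l x = Poly_Mapping.lookup (t + ones) x"
      by (simp add: t_def lookup_add lookup_minus)
  qed
  have "t \<notin> mons M"
    using D(4) l l' strongly_divides_add_ones mons_iff_min_gens by metis
  moreover have "t + expo x \<in> mons M" for x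
  proof -
    obtain m where m: "m \<in> D" "x = f m" using surj by (metis imageE UNIV_I)
    have "Poly_Mapping.lookup m y \<le> Poly_Mapping.lookup (t + expo x) y" for y
    proof (cases "y = x")
      case True
      then show ?thesis using le[OF m(1), of y] l' by (simp add: lookup_add)
    next
      case False
      then obtain m' where m': "m' \<in> D" "y = f m'" "m' \<noteq> m" using surj m by (metis imageE UNIV_I)
      then have "Poly_Mapping.lookup m y < Poly_Mapping.lookup l y"
        using f[OF m'(1) m(1)] l_eq[OF m'(1)] by simp
      then show ?thesis using l' by (simp add: lookup_add)
    qed
    then have "mon_le m (t + expo x)" by (simp add: mon_le_def)
    then show ?thesis using m D(1) mons_iff_min_gens by blast
  qed
  ultimately show ?thesis using l' by (auto simp: socle_mons_def)
qed

lemma lcm_set_eq: "lcm_set M = (\<lambda>t. t + ones) ` socle_mons M"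
  using lcm_of_socle_monomial socle_monomial_of_lcm by blast

lemma lcm_set_degree_eq:
  "{l \<in> lcm_set M. mdeg l = j} = (\<lambda>t. t + ones) ` {t \<in> socle_mons M. mdeg t + CARD('n) = j}"
  by (auto simp: lcm_set_eq mdeg_add mdeg_ones)

end

section \<open>Ideals generated by variables\<close>

definition var_ideal :: "'n set \<Rightarrow> ('n, 'k::field) mpol set" where
  "var_ideal X = {p. \<forall>t. (\<forall>x\<in>X. Poly_Mapping.lookup t x = 0) \<longrightarrow> Poly_Mapping.lookup p t = 0}"

lemma var_idealI:
  "(\<And>t. (\<And>x. x \<in> X \<Longrightarrow> Poly_Mapping.lookup t x = 0) \<Longrightarrow> Poly_Mapping.lookup p t = 0) \<Longrightarrow> p \<in> var_ideal X"
  by (simp add: var_ideal_def)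

lemma var_ideal_zero [simp]: "0 \<in> var_ideal X"
  by (simp add: var_ideal_def)

lemma var_ideal_add: "p \<in> var_ideal X \<Longrightarrow> q \<in> var_ideal X \<Longrightarrow> p + q \<in> var_ideal X"
  by (simp add: var_ideal_def lookup_add)

lemma var_ideal_diff: "p \<in> var_ideal X \<Longrightarrow> q \<in> var_ideal X \<Longrightarrow> p - q \<in> var_ideal X"
  by (simp add: var_ideal_def lookup_minus)

lemma var_ideal_sum: "(\<And>i. i \<in> I \<Longrightarrow> f i \<in> var_ideal X) \<Longrightarrow> sum f I \<in> var_ideal X"
  by (simp add: var_ideal_def lookup_sum)

lemma var_ideal_mult:
  assumes "p \<in> var_ideal X"
  shows "q * p \<in> var_ideal X"
proof (rule var_idealI, rule ccontr)
  fix t assume t: "\<And>x. x \<in> X \<Longrightarrow> Poly_Mapping.lookup t x = 0" and "Poly_Mapping.lookup (q * p) t \<noteq> 0"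
  then obtain a b where ab: "t = a + b" "Poly_Mapping.lookup p b \<noteq> 0"
    using keys_mult_obtain by metis
  have "Poly_Mapping.lookup b x = 0" if "x \<in> X" for x
    using t[OF that] ab(1) by (simp add: lookup_add)
  with assms ab(2) show False by (auto simp: var_ideal_def)
qed

lemma var_ideal_mono: "X \<subseteq> Y \<Longrightarrow> var_ideal X \<subseteq> var_ideal Y"
  by (auto simp: var_ideal_def)

lemma var_ideal_empty: "p \<in> var_ideal {} \<longleftrightarrow> p = 0"
  by (auto simp: var_ideal_def intro: poly_mapping_eqI)

lemma var_ideal_UNIV: "p \<in> var_ideal UNIV \<longleftrightarrow> Poly_Mapping.lookup p 0 = 0"
proof -
  have "(\<forall>x. Poly_Mapping.lookup t x = 0) \<longleftrightarrow> t = 0" for t :: "'a \<Rightarrow>\<^sub>0 nat"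
    by (auto intro: poly_mapping_eqI)
  then show ?thesis by (simp add: var_ideal_def)
qed

lemma lookup_var_mult:
  "Poly_Mapping.lookup (var x * p) t =
    (if Poly_Mapping.lookup t x \<noteq> 0 then Poly_Mapping.lookup p (t - expo x) else 0)"
  by (simp add: monom_poly_def lookup_single_mult mon_le_expo)

lemma var_mult_in_insert: "var x * p \<in> var_ideal (insert x X)"
  by (rule var_idealI) (simp add: lookup_var_mult)

text \<open>
  The variable \<open>x\<close> is regular on \<open>S / (X)\<close>.
\<close>
lemma var_regular:
  fixes p :: "('a, 'k::field) mpol"
  assumes "x \<notin> X" "var x * p \<in> var_ideal X"
  shows "p \<in> var_ideal X"
proof (rule var_idealI)
  fix t :: "'a mon" assume t: "\<And>y. y \<in> X \<Longrightarrow> Poly_Mapping.lookup t y = 0"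
  have "\<forall>y\<in>X. Poly_Mapping.lookup (expo x + t) y = 0"
    using t assms(1) by (auto simp: lookup_add)
  then have "Poly_Mapping.lookup (var x * p) (expo x + t) = 0"
    using assms(2) by (simp add: var_ideal_def)
  then show "Poly_Mapping.lookup p t = 0" by (simp add: lookup_var_mult lookup_add)
qed

text \<open>
  The quotient collects the terms of \<open>p\<close> that contain \<open>x\<close>. Among the remaining terms, which are free
  of \<open>x\<close>, none is free of all variables in \<open>X\<close>.
\<close>
lemma var_division:
  fixes p :: "('n, 'k::field) mpol"
  assumes "p \<in> var_ideal (insert x X)"
  shows "\<exists>q. p - var x * q \<in> var_ideal X"
proof -
  define q where "q = Poly_Mapping.Abs_poly_mapping (\<lambda>s. Poly_Mapping.lookup p (s + expo x))"
  have "inj (\<lambda>s :: 'n mon. s + expo x)" by (simp add: inj_def)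
  then have "finite ((\<lambda>s. s + expo x) -` Poly_Mapping.keys p)"
    by (intro finite_vimageI) auto
  then have "finite {s. Poly_Mapping.lookup p (s + expo x) \<noteq> 0}"
    by (simp add: vimage_def in_keys_iff)
  then have q: "Poly_Mapping.lookup q s = Poly_Mapping.lookup p (s + expo x)" for s
    unfolding q_def by (simp add: lookup_Abs_poly_mapping)
  have "p - var x * q \<in> var_ideal X"
  proof (rule var_idealI)
    fix t :: "'n mon" assume t: "\<And>y. y \<in> X \<Longrightarrow> Poly_Mapping.lookup t y = 0"
    show "Poly_Mapping.lookup (p - var x * q) t = 0"
    proof (cases "Poly_Mapping.lookup t x = 0")
      case True
      then have "Poly_Mapping.lookup p t = 0"
        using assms t by (auto simp: var_ideal_def)
      with True show ?thesis by (simp add: lookup_minus lookup_var_mult)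
    next
      case False
      then have "mon_le (expo x) t" by (simp add: mon_le_expo)
      then show ?thesis using False by (simp add: lookup_minus lookup_var_mult q mon_le_diff_add)
    qed
  qed
  then show ?thesis ..
qed

section \<open>Homogeneous components\<close>

definition hom_comp :: "int \<Rightarrow> ('n::finite, 'k::field) mpol \<Rightarrow> ('n, 'k) mpol" where
  "hom_comp j p = Poly_Mapping.Abs_poly_mapping
     (\<lambda>t. if int (mdeg t) = j then Poly_Mapping.lookup p t else 0)"

lemma lookup_hom_comp:
  "Poly_Mapping.lookup (hom_comp j p) t = (if int (mdeg t) = j then Poly_Mapping.lookup p t else 0)"
proof -
  have "finite {t. (if int (mdeg t) = j then Poly_Mapping.lookup p t else 0) \<noteq> 0}"
    by (rule finite_subset[of _ "Poly_Mapping.keys p"]) (auto simp: in_keys_iff)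
  then show ?thesis unfolding hom_comp_def by (subst lookup_Abs_poly_mapping) auto
qed

lemma hom_comp_zero [simp]: "hom_comp j 0 = 0"
  by (rule poly_mapping_eqI) (simp add: lookup_hom_comp)

lemma hom_comp_diff: "hom_comp j (p - q) = hom_comp j p - hom_comp j q"
  by (rule poly_mapping_eqI) (simp add: lookup_hom_comp lookup_minus)

lemma hom_comp_sum: "hom_comp j (sum f I) = (\<Sum>i\<in>I. hom_comp j (f i))"
  by (rule poly_mapping_eqI) (simp add: lookup_hom_comp lookup_sum)

text \<open>
  Multiplication by a homogeneous polynomial of degree \<open>k\<close> shifts degrees by \<open>k\<close>.
\<close>
lemma hom_comp_mult:
  assumes "homogeneous q k"
  shows "hom_comp j (q * p) = q * hom_comp (j - k) p"
proof (rule poly_mapping_eqI)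
  fix t
  have deg: "int (mdeg (a + b)) = k + int (mdeg b)" if "Poly_Mapping.lookup q a \<noteq> 0" for a b
    using assms that by (simp add: homogeneous_def in_keys_iff mdeg_add)
  show "Poly_Mapping.lookup (hom_comp j (q * p)) t = Poly_Mapping.lookup (q * hom_comp (j - k) p) t"
  proof (cases "int (mdeg t) = j")
    case True
    have "Poly_Mapping.lookup (q * (p - hom_comp (j - k) p)) t = 0"
    proof (rule ccontr)
      assume "Poly_Mapping.lookup (q * (p - hom_comp (j - k) p)) t \<noteq> 0"
      then obtain a b where ab: "t = a + b" "Poly_Mapping.lookup q a \<noteq> 0"
          "Poly_Mapping.lookup (p - hom_comp (j - k) p) b \<noteq> 0"
        using keys_mult_obtain by blast
      then show False using deg[OF ab(2), of b] True
        by (simp add: lookup_minus lookup_hom_comp split: if_splits)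
    qed
    then show ?thesis using True by (simp add: lookup_hom_comp right_diff_distrib lookup_minus)
  next
    case False
    have "Poly_Mapping.lookup (q * hom_comp (j - k) p) t = 0"
    proof (rule ccontr)
      assume "Poly_Mapping.lookup (q * hom_comp (j - k) p) t \<noteq> 0"
      then obtain a b where ab: "t = a + b" "Poly_Mapping.lookup q a \<noteq> 0"
          "Poly_Mapping.lookup (hom_comp (j - k) p) b \<noteq> 0"
        using keys_mult_obtain by blast
      then show False using deg[OF ab(2), of b] False
        by (simp add: lookup_hom_comp split: if_splits)
    qed
    with False show ?thesis by (simp add: lookup_hom_comp)
  qed
qed

lemma homogeneous_var: "homogeneous (var x) 1"
  by (simp add: homogeneous_def monom_poly_def)

lemma hom_comp_var_ideal: "p \<in> var_ideal X \<Longrightarrow> hom_comp j p \<in> var_ideal X"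
  by (simp add: var_ideal_def lookup_hom_comp)

lemma hom_comp_in_monomial_ideal:
  assumes "monomial_ideal M" "p \<in> M"
  shows "hom_comp j p \<in> M"
  using assms(2) unfolding in_monomial_ideal_iff[OF assms(1)]
  by (auto simp: in_keys_iff lookup_hom_comp split: if_splits)

section \<open>Spaces of functions over a field\<close>

lemma vector_space_fun: "vector_space (\<lambda>(c::'k::field) (f :: 'a \<Rightarrow> 'k) x. c * f x)"
  by unfold_locales (auto simp: fun_eq_iff algebra_simps)

context
begin

interpretation fun_space: vector_space "\<lambda>(c::'k::field) (f :: 'a \<Rightarrow> 'k) x. c * f x"
  by (rule vector_space_fun)

lemma fun_sum_apply: "(\<Sum>i\<in>I. f i) x = (\<Sum>i\<in>I. f i x)"
  for f :: "'i \<Rightarrow> 'a \<Rightarrow> 'k::comm_monoid_add"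
  by (induction I rule: infinite_finite_induct) auto

lemma finite_support_in_span:
  fixes f :: "'a \<Rightarrow> 'k::field"
  assumes "finite T" "\<And>t. t \<notin> T \<Longrightarrow> f t = 0"
  shows "f \<in> fun_space.span ((\<lambda>t. (\<lambda>s. if s = t then 1 else 0)) ` T)"
proof -
  have "f = (\<Sum>t\<in>T. (\<lambda>x. f t * (if x = t then 1 else 0)))"
  proof
    fix x
    have "(\<Sum>t\<in>T. f t * (if x = t then 1 else 0)) = (\<Sum>t\<in>T. if x = t then f t else 0)"
      by (rule sum.cong) auto
    then show "f x = (\<Sum>t\<in>T. (\<lambda>x. f t * (if x = t then 1 else 0))) x"
      using assms by (simp add: fun_sum_apply)
  qed
  also have "\<dots> \<in> fun_space.span ((\<lambda>t. (\<lambda>s. if s = t then 1 else 0)) ` T)"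
    by (intro fun_space.span_sum fun_space.span_scale fun_space.span_base) auto
  finally show ?thesis .
qed

lemma card_le_if_trivial_kernel_finite:
  fixes a :: "'b \<Rightarrow> 't \<Rightarrow> 'k::field"
  assumes T: "finite T" and S: "finite S"
    and triv: "\<And>c. (\<And>t. t \<in> T \<Longrightarrow> (\<Sum>b\<in>S. c b * a b t) = 0) \<Longrightarrow> \<forall>b\<in>S. c b = 0"
  shows "card S \<le> card T"
proof -
  define f where "f b = (\<lambda>t. if t \<in> T then a b t else 0)" for b
  have inj: "inj_on f S"
  proof (rule inj_onI, rule ccontr)
    fix b b' assume b: "b \<in> S" "b' \<in> S" "f b = f b'" "b \<noteq> b'"
    have "\<forall>i\<in>S. (if i = b then 1 else if i = b' then -1 else 0 :: 'k) = 0"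
    proof (rule triv)
      fix t assume "t \<in> T"
      then have ab: "a b t = a b' t" using b(3) by (simp add: f_def fun_eq_iff) metis
      have "(\<Sum>i\<in>S. (if i = b then 1 else if i = b' then -1 else 0) * a i t) =
          (\<Sum>i\<in>S. (if i = b then a b t else 0) - (if i = b' then a b' t else 0))"
        by (rule sum.cong) (use b(4) in auto)
      also have "\<dots> = 0" using S b ab by (simp add: sum_subtractf sum.delta)
      finally show "(\<Sum>i\<in>S. (if i = b then 1 else if i = b' then -1 else 0) * a i t) = 0" .
    qed
    with b(1) show False by force
  qed
  have "fun_space.independent (f ` S)"
  proof (rule fun_space.independent_if_scalars_zero)
    show "finite (f ` S)" using S by simp
  next
    fix c v assume z: "(\<Sum>v\<in>f ` S. (\<lambda>x. c v * v x)) = 0" and v: "v \<in> f ` S"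
    have "\<forall>b\<in>S. c (f b) = 0"
    proof (rule triv)
      fix t assume t: "t \<in> T"
      have "(\<Sum>v\<in>f ` S. (\<lambda>x. c v * v x)) t = 0" by (simp add: z)
      then have "(\<Sum>b\<in>S. c (f b) * f b t) = 0"
        by (simp add: fun_sum_apply sum.reindex[OF inj])
      then show "(\<Sum>b\<in>S. c (f b) * a b t) = 0" using t by (simp add: f_def)
    qed
    with v show "c v = 0" by blast
  qed
  moreover have "f ` S \<subseteq> fun_space.span ((\<lambda>t. (\<lambda>s. if s = t then 1 else 0)) ` T)"
    by (auto intro!: finite_support_in_span[OF T] simp: f_def)
  ultimately have "card (f ` S) \<le> card ((\<lambda>t. (\<lambda>s. if s = t then 1 else 0 :: 'k)) ` T)"
    using fun_space.independent_span_bound T by blast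
  also have "\<dots> \<le> card T" by (rule card_image_le[OF T])
  finally show ?thesis by (simp add: card_image[OF inj])
qed

end

text \<open>
  Dimension comparison in the form used for the two directions of the count: a matrix with rows
  \<open>T\<close> and columns \<open>B\<close> whose columns are linearly independent has at most \<open>card T\<close> columns.
  Independence is only asked for finite sets of columns, so that \<open>B\<close> is shown to be finite.
\<close>
lemma card_le_if_trivial_kernel:
  fixes a :: "'b \<Rightarrow> 't \<Rightarrow> 'k::field"
  assumes T: "finite T"
    and triv: "\<And>S c. finite S \<Longrightarrow> S \<subseteq> B \<Longrightarrow> (\<And>t. t \<in> T \<Longrightarrow> (\<Sum>b\<in>S. c b * a b t) = 0)
      \<Longrightarrow> \<forall>b\<in>S. c b = 0"
  shows "finite B \<and> card B \<le> card T"
proof (rule finite_if_finite_subsets_card_bdd)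
  show "card S \<le> card T" if "S \<subseteq> B" "finite S" for S
    by (rule card_le_if_trivial_kernel_finite[OF T that(2), of a]) (rule triv[OF that(2,1)])
qed

section \<open>Matrices acting on functions\<close>

text \<open>
  Elements of a free module of rank \<open>m\<close> are represented by functions on \<open>nat\<close> of which only the values
  below \<open>m\<close> matter. This frees linear manipulations from carrier conditions.
\<close>
definition mat_app :: "'a::comm_ring_1 mat \<Rightarrow> (nat \<Rightarrow> 'a) \<Rightarrow> nat \<Rightarrow> 'a" where
  "mat_app A v = (\<lambda>a. \<Sum>b<dim_col A. A $$ (a, b) * v b)"

lemma mult_mat_vec_eq_mat_app:
  assumes "A \<in> carrier_mat m n"
  shows "A *\<^sub>v vec n v = vec m (mat_app A v)"
  using assms
  by (intro eq_vecI) (auto simp: mat_app_def scalar_prod_def lessThan_atLeast0 intro!: sum.cong)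

lemma vec_vec_index: "v \<in> carrier_vec m \<Longrightarrow> vec m (vec_index v) = v"
  by (intro eq_vecI) auto

lemma mat_image_iff:
  assumes "A \<in> carrier_mat m n"
  shows "vec m v \<in> mat_image A \<longleftrightarrow> (\<exists>w. \<forall>a<m. v a = mat_app A w a)"
proof
  assume "vec m v \<in> mat_image A"
  then obtain w where w: "w \<in> carrier_vec n" "vec m v = A *\<^sub>v w"
    using assms by (auto simp: mat_image_def)
  then have "vec m v = vec m (mat_app A (vec_index w))"
    using mult_mat_vec_eq_mat_app[OF assms] vec_vec_index by metis
  then show "\<exists>w. \<forall>a<m. v a = mat_app A w a" by (metis index_vec)
next
  assume "\<exists>w. \<forall>a<m. v a = mat_app A w a"
  then obtain w where "\<forall>a<m. v a = mat_app A w a" ..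
  then have "vec m v = A *\<^sub>v vec n w"
    unfolding mult_mat_vec_eq_mat_app[OF assms] by (intro eq_vecI) auto
  then show "vec m v \<in> mat_image A"
    using assms by (auto simp: mat_image_def)
qed

lemma mat_kernel_iff:
  assumes "A \<in> carrier_mat m n"
  shows "vec n v \<in> mat_kernel A \<longleftrightarrow> (\<forall>a<m. mat_app A v a = 0)"
proof -
  have "vec m (mat_app A v) = 0\<^sub>v m \<longleftrightarrow> (\<forall>a<m. mat_app A v a = 0)"
    by (auto simp: vec_eq_iff)
  then show ?thesis
    using assms by (auto simp: mat_kernel_def mult_mat_vec_eq_mat_app[OF assms])
qed

section \<open>The top free module and the socle\<close>

locale resolution =
  fixes M :: "('n::finite, 'k::field) mpol set" and degs e d
  assumes M: "monomial_ideal M"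
    and res: "minimal_graded_free_resolution M degs e d"
begin

abbreviation rk :: "nat \<Rightarrow> nat" where
  "rk i \<equiv> length (degs i)"

definition aug :: "(nat \<Rightarrow> ('n, 'k) mpol) \<Rightarrow> ('n, 'k) mpol" where
  "aug v = (\<Sum>b<rk 0. e $ b * v b)"

definition diff :: "nat \<Rightarrow> (nat \<Rightarrow> ('n, 'k) mpol) \<Rightarrow> nat \<Rightarrow> ('n, 'k) mpol" where
  "diff i v = (\<lambda>a. \<Sum>b<rk (Suc i). d i $$ (a, b) * v b)"

lemma aug_add: "aug (v + w) = aug v + aug w"
  by (simp add: aug_def distrib_left sum.distrib)

lemma aug_scale: "aug (\<lambda>b. c * v b) = c * aug v"
  by (simp add: aug_def sum_distrib_left mult_ac)

lemma diff_add: "diff i (v + w) = diff i v + diff i w"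
  by (auto simp: diff_def distrib_left sum.distrib fun_eq_iff)

lemma diff_minus: "diff i (v - w) = diff i v - diff i w"
  by (auto simp: diff_def right_diff_distrib sum_subtractf fun_eq_iff)

lemma diff_scale: "diff i (\<lambda>b. c * v b) = (\<lambda>a. c * diff i v a)"
  by (auto simp: diff_def sum_distrib_left mult_ac fun_eq_iff)

lemma diff_zero [simp]: "diff i (\<lambda>_. 0) = (\<lambda>_. 0)"
  by (simp add: diff_def)

lemma d_carrier: "d i \<in> carrier_mat (rk i) (rk (Suc i))"
  using res by (simp add: minimal_graded_free_resolution_def graded_map_def)

lemma diff_eq_mat_app: "diff i v = mat_app (d i) v"
  using d_carrier[of i] by (auto simp: diff_def mat_app_def)

lemma aug_surj: "\<exists>v. f - aug v \<in> M"
proof -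
  have "\<exists>v\<in>carrier_vec (rk 0). f - e \<bullet> v \<in> M"
    using res unfolding minimal_graded_free_resolution_def by blast
  then obtain v where v: "v \<in> carrier_vec (rk 0)" "f - e \<bullet> v \<in> M" by blast
  then have "e \<bullet> v = aug (vec_index v)"
    by (auto simp: aug_def scalar_prod_def lessThan_atLeast0)
  with v show ?thesis by metis
qed

lemma aug_in_ideal_iff: "aug v \<in> M \<longleftrightarrow> (\<exists>w. \<forall>a<rk 0. v a = diff 0 w a)"
proof -
  have "aug v = e \<bullet> vec (rk 0) v"
    by (auto simp: aug_def scalar_prod_def lessThan_atLeast0)
  moreover have "e \<bullet> vec (rk 0) v \<in> M \<longleftrightarrow> vec (rk 0) v \<in> mat_image (d 0)"
    using res by (auto simp: minimal_graded_free_resolution_def)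
  ultimately show ?thesis by (simp add: mat_image_iff[OF d_carrier] diff_eq_mat_app)
qed

lemma diff_eq_zero_iff:
  "(\<forall>a<rk i. diff i v a = 0) \<longleftrightarrow> (\<exists>w. \<forall>a<rk (Suc i). v a = diff (Suc i) w a)"
proof -
  have "mat_kernel (d i) = mat_image (d (Suc i))"
    using res by (simp add: minimal_graded_free_resolution_def)
  then show ?thesis
    using mat_kernel_iff[OF d_carrier, of i v] mat_image_iff[OF d_carrier, of "Suc i" v]
    by (simp add: diff_eq_mat_app)
qed

lemma diff_diff: "a < rk i \<Longrightarrow> diff i (diff (Suc i) w) a = 0"
  using diff_eq_zero_iff[of i "diff (Suc i) w"] by blast

text \<open>
  Equality in \<open>F\<^sub>i / (X) F\<^sub>i\<close>.
\<close>
definition cong_mod :: "'n set \<Rightarrow> nat \<Rightarrow> (nat \<Rightarrow> ('n, 'k) mpol) \<Rightarrow> (nat \<Rightarrow> ('n, 'k) mpol) \<Rightarrow> bool" where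
  "cong_mod X i v w \<longleftrightarrow> (\<forall>a<rk i. v a - w a \<in> var_ideal X)"

lemma cong_mod_refl [simp]: "cong_mod X i v v"
  by (simp add: cong_mod_def)

lemma cong_mod_sym: "cong_mod X i v w \<Longrightarrow> cong_mod X i w v"
  unfolding cong_mod_def
proof (intro allI impI)
  fix a assume "\<forall>a<rk i. v a - w a \<in> var_ideal X" "a < rk i"
  then have "0 - (v a - w a) \<in> var_ideal X" by (blast intro: var_ideal_diff var_ideal_zero)
  then show "w a - v a \<in> var_ideal X" by simp
qed

lemma cong_mod_trans: "cong_mod X i u v \<Longrightarrow> cong_mod X i v w \<Longrightarrow> cong_mod X i u w"
  unfolding cong_mod_def
proof (intro allI impI)
  fix a assume *: "\<forall>a<rk i. u a - v a \<in> var_ideal X" "\<forall>a<rk i. v a - w a \<in> var_ideal X" "a < rk i"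
  have "(u a - v a) + (v a - w a) \<in> var_ideal X" using * by (blast intro: var_ideal_add)
  then show "u a - w a \<in> var_ideal X" by simp
qed

lemma cong_mod_mono: "cong_mod X i v w \<Longrightarrow> X \<subseteq> Y \<Longrightarrow> cong_mod Y i v w"
  using var_ideal_mono by (fastforce simp: cong_mod_def)

lemma cong_mod_add: "cong_mod X i v w \<Longrightarrow> cong_mod X i v' w' \<Longrightarrow> cong_mod X i (v + v') (w + w')"
  using var_ideal_add by (fastforce simp: cong_mod_def add_diff_add)

lemma cong_mod_minus: "cong_mod X i v w \<Longrightarrow> cong_mod X i v' w' \<Longrightarrow> cong_mod X i (v - v') (w - w')"
  unfolding cong_mod_def
proof (intro allI impI)
  fix a assume *: "\<forall>a<rk i. v a - w a \<in> var_ideal X" "\<forall>a<rk i. v' a - w' a \<in> var_ideal X" "a < rk i"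
  have "(v a - w a) - (v' a - w' a) \<in> var_ideal X" using * by (blast intro: var_ideal_diff)
  then show "(v - v') a - (w - w') a \<in> var_ideal X" by (simp add: algebra_simps)
qed

lemma cong_mod_scale: "cong_mod X i v w \<Longrightarrow> cong_mod X i (\<lambda>a. c * v a) (\<lambda>a. c * w a)"
  using var_ideal_mult by (auto simp: cong_mod_def right_diff_distrib[symmetric])

lemma cong_mod_cancel:
  assumes "x \<notin> X" "cong_mod X i (\<lambda>a. var x * v a) (\<lambda>a. var x * w a)"
  shows "cong_mod X i v w"
  using assms(2) by (auto simp: cong_mod_def right_diff_distrib[symmetric] intro: var_regular[OF assms(1)])

lemma cong_mod_insert:
  "cong_mod (insert x X) i v w \<longleftrightarrow> (\<exists>z. cong_mod X i v (w + (\<lambda>a. var x * z a)))"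
proof
  assume "cong_mod (insert x X) i v w"
  then have "\<forall>a. \<exists>q. a < rk i \<longrightarrow> (v a - w a) - var x * q \<in> var_ideal X"
    by (auto simp: cong_mod_def intro: var_division)
  then obtain z where "\<forall>a<rk i. (v a - w a) - var x * z a \<in> var_ideal X" by metis
  then show "\<exists>z. cong_mod X i v (w + (\<lambda>a. var x * z a))"
    by (auto simp: cong_mod_def diff_diff_eq)
next
  assume "\<exists>z. cong_mod X i v (w + (\<lambda>a. var x * z a))"
  then obtain z where "cong_mod X i v (w + (\<lambda>a. var x * z a))" ..
  then have "cong_mod (insert x X) i v (w + (\<lambda>a. var x * z a))"
    by (rule cong_mod_mono) auto
  moreover have "cong_mod (insert x X) i (w + (\<lambda>a. var x * z a)) w"
    using var_mult_in_insert by (auto simp: cong_mod_def)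
  ultimately show "cong_mod (insert x X) i v w" by (rule cong_mod_trans)
qed

lemma cong_mod_diff: "cong_mod X (Suc i) v w \<Longrightarrow> cong_mod X i (diff i v) (diff i w)"
  by (auto simp: cong_mod_def diff_def sum_subtractf[symmetric] right_diff_distrib[symmetric]
      intro!: var_ideal_sum var_ideal_mult)

lemma cong_mod_diff_diff: "cong_mod X i (diff i (diff (Suc i) w)) (\<lambda>_. 0)"
  by (simp add: cong_mod_def diff_diff)

text \<open>
  Cycles and boundaries of the complex \<open>F / (X) F\<close>. In position 0 everything is a cycle.
\<close>
definition cycle :: "'n set \<Rightarrow> nat \<Rightarrow> (nat \<Rightarrow> ('n, 'k) mpol) \<Rightarrow> bool" where
  "cycle X i v \<longleftrightarrow> (\<forall>k. i = Suc k \<longrightarrow> cong_mod X k (diff k v) (\<lambda>_. 0))"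

definition boundary :: "'n set \<Rightarrow> nat \<Rightarrow> (nat \<Rightarrow> ('n, 'k) mpol) \<Rightarrow> bool" where
  "boundary X i v \<longleftrightarrow> (\<exists>w. cong_mod X i v (diff i w))"

lemma boundary_insert:
  "boundary (insert x X) i v \<longleftrightarrow> (\<exists>w z. cong_mod X i v (diff i w + (\<lambda>a. var x * z a)))"
  by (simp add: boundary_def cong_mod_insert)

lemma cycle_Suc: "cycle X (Suc k) v \<longleftrightarrow> cong_mod X k (diff k v) (\<lambda>_. 0)"
  by (simp add: cycle_def)

text \<open>
  If \<open>x v\<close> is a boundary modulo \<open>X\<close>, then \<open>x\<close> annihilates the differential of \<open>v\<close> modulo \<open>X\<close>, and
  regularity of \<open>x\<close> makes \<open>v\<close> a cycle.
\<close>
lemma cycle_cancel: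
  assumes "x \<notin> X" "cong_mod X i (diff i w) (\<lambda>a. var x * v a)"
  shows "cycle X i v"
  unfolding cycle_def
proof (intro allI impI)
  fix k assume i: "i = Suc k"
  have "cong_mod X k (diff k (\<lambda>a. var x * v a)) (diff k (diff (Suc k) w))"
    using cong_mod_diff cong_mod_sym assms(2) i by blast
  then have "cong_mod X k (\<lambda>a. var x * diff k v a) (\<lambda>_. 0)"
    using cong_mod_trans[OF _ cong_mod_diff_diff] by (simp add: diff_scale)
  then show "cong_mod X k (diff k v) (\<lambda>_. 0)"
    using cong_mod_cancel[OF assms(1), of k "diff k v" "\<lambda>_. 0"] by simp
qed

text \<open>
  Induction on the killed variables. The differential of a cycle \<open>v\<close> modulo \<open>(x, X)\<close> is \<open>x y\<close>
  modulo \<open>X\<close>, where \<open>y\<close> is a cycle modulo \<open>X\<close> one position lower. That position is still high enough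
  for \<open>y\<close> to be a boundary, say of \<open>w\<close>. Then \<open>v - x w\<close> is a cycle modulo \<open>X\<close>, hence a
  boundary.
\<close>
lemma acyclic_above:
  assumes "distinct xs" "length xs < i" "cycle (set xs) i v"
  shows "boundary (set xs) i v"
  using assms
proof (induction xs arbitrary: i v)
  case Nil
  then obtain k where i: "i = Suc k" by (cases i) auto
  then have "\<forall>a<rk k. diff k v a = 0"
    using Nil by (simp add: cycle_Suc cong_mod_def var_ideal_empty)
  then obtain w where "\<forall>a<rk i. v a = diff i w a" using diff_eq_zero_iff i by blast
  then show ?case by (auto simp: boundary_def cong_mod_def var_ideal_empty)
next
  case (Cons x xs)
  then obtain k where i: "i = Suc k" by (cases i) auto
  from Cons.prems have x: "x \<notin> set xs" "distinct xs" by auto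
  from Cons.prems i obtain y where
    "cong_mod (set xs) k (diff k v) ((\<lambda>_. 0) + (\<lambda>a. var x * y a))"
    by (auto simp: cycle_Suc cong_mod_insert)
  then have y: "cong_mod (set xs) k (diff k v) (\<lambda>a. var x * y a)"
    by (simp add: plus_fun_def)
  then have "cycle (set xs) k y" by (rule cycle_cancel[OF x(1)])
  then have "boundary (set xs) k y" using Cons.IH[OF x(2)] Cons.prems(2) i by simp
  then obtain w where w: "cong_mod (set xs) k y (diff k w)" by (auto simp: boundary_def)
  have "cong_mod (set xs) k (diff k v) (\<lambda>a. var x * diff k w a)"
    using cong_mod_trans[OF y cong_mod_scale[OF w]] .
  then have "cong_mod (set xs) k (diff k v - (\<lambda>a. var x * diff k w a))
      ((\<lambda>a. var x * diff k w a) - (\<lambda>a. var x * diff k w a))"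
    by (rule cong_mod_minus) simp
  then have "cycle (set xs) i (v - (\<lambda>a. var x * w a))"
    by (simp add: i cycle_Suc diff_minus diff_scale zero_fun_def)
  moreover have "length xs < i" using Cons.prems(2) by simp
  ultimately have "boundary (set xs) i (v - (\<lambda>a. var x * w a))"
    using Cons.IH[OF x(2)] by blast
  then obtain w' where "cong_mod (set xs) i (v - (\<lambda>a. var x * w a)) (diff i w')"
    by (auto simp: boundary_def)
  then have "cong_mod (set xs) i (v - (\<lambda>a. var x * w a) + (\<lambda>a. var x * w a)) (diff i w' + (\<lambda>a. var x * w a))"
    by (rule cong_mod_add) simp
  then show ?case by (auto simp: boundary_insert)
qed

text \<open>
  For \<open>xs = [x\<^sub>r, \<dots>, x\<^sub>1]\<close>, an element of \<open>F\<^sub>r\<close> is related to a polynomial if they correspond under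
  \<open>H\<^sub>r(F / (x\<^sub>1, \<dots>, x\<^sub>r) F) \<cong> (M : (x\<^sub>1, \<dots>, x\<^sub>r)) / M\<close>. The recursive step is the connecting
  homomorphism of the short exact sequence given by multiplication with the newest variable: apply the
  differential and divide by the variable.
\<close>
primrec zigzag :: "'n list \<Rightarrow> (nat \<Rightarrow> ('n, 'k) mpol) \<Rightarrow> ('n, 'k) mpol \<Rightarrow> bool" where
  "zigzag [] v u \<longleftrightarrow> aug v - u \<in> M"
| "zigzag (x # xs) w u \<longleftrightarrow>
    (\<exists>v. cong_mod (set xs) (length xs) (diff (length xs) w) (\<lambda>a. var x * v a) \<and> zigzag xs v u)"

lemma zigzag_add: "zigzag xs v u \<Longrightarrow> zigzag xs v' u' \<Longrightarrow> zigzag xs (v + v') (u + u')"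
proof (induction xs arbitrary: v v')
  case Nil
  then have "(aug v - u) + (aug v' - u') \<in> M" using ideal_add[OF M] by simp
  then show ?case by (simp only: zigzag.simps aug_add add_diff_add)
next
  case (Cons x xs)
  then obtain y y' where
    y: "cong_mod (set xs) (length xs) (diff (length xs) v) (\<lambda>a. var x * y a)" "zigzag xs y u" and
    y': "cong_mod (set xs) (length xs) (diff (length xs) v') (\<lambda>a. var x * y' a)" "zigzag xs y' u'"
    by auto
  have "cong_mod (set xs) (length xs) (diff (length xs) (v + v')) (\<lambda>a. var x * (y + y') a)"
    using cong_mod_add[OF y(1) y'(1)] by (simp add: diff_add distrib_left plus_fun_def[of "\<lambda>a. var x * y a"])
  with Cons.IH[OF y(2) y'(2)] show ?case unfolding zigzag.simps by blast
qed

lemma zigzag_scale: "zigzag xs v u \<Longrightarrow> zigzag xs (\<lambda>a. c * v a) (c * u)"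
proof (induction xs arbitrary: v)
  case Nil
  then have "c * (aug v - u) \<in> M" using ideal_mult[OF M] by simp
  then show ?case by (simp add: aug_scale algebra_simps)
next
  case (Cons x xs)
  then obtain y where
    y: "cong_mod (set xs) (length xs) (diff (length xs) v) (\<lambda>a. var x * y a)" "zigzag xs y u"
    by auto
  have "cong_mod (set xs) (length xs) (diff (length xs) (\<lambda>a. c * v a)) (\<lambda>a. var x * (c * y a))"
    using cong_mod_scale[OF y(1), of c] by (simp add: diff_scale mult.left_commute[of c])
  moreover have "zigzag xs (\<lambda>a. c * y a) (c * u)" by (rule Cons.IH[OF y(2)])
  ultimately show ?case unfolding zigzag.simps by (intro exI[of _ "\<lambda>a. c * y a"] conjI)
qed

lemma zigzag_ideal: "u \<in> M \<Longrightarrow> zigzag xs (\<lambda>_. 0) u"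
proof (induction xs)
  case Nil
  then show ?case using ideal_diff[OF M ideal_zero[OF M]] by (simp add: aug_def)
next
  case (Cons x xs)
  then have "cong_mod (set xs) (length xs) (diff (length xs) (\<lambda>_. 0)) (\<lambda>a. var x * 0)" by simp
  with Cons show ?case unfolding zigzag.simps by (intro exI[of _ "\<lambda>_. 0"] conjI) auto
qed

lemma zigzag_sum: "(\<And>i. i \<in> I \<Longrightarrow> zigzag xs (v i) (u i)) \<Longrightarrow> zigzag xs (\<Sum>i\<in>I. v i) (\<Sum>i\<in>I. u i)"
proof (induction I rule: infinite_finite_induct)
  case (insert i I)
  have "zigzag xs (v i + sum v I) (u i + sum u I)" using insert by (intro zigzag_add) auto
  then show ?case using insert(1,2) by (simp only: sum.insert[OF insert(1,2)])
qed (use zigzag_ideal[of 0 xs] ideal_zero[OF M] in \<open>auto simp: zero_fun_def\<close>)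

text \<open>
  Injectivity of the correspondence, from homology to \<open>S/M\<close>. The element one position lower
  is a boundary of some \<open>z\<close> by induction, so subtracting \<open>x z\<close> gives a cycle in a position where the
  homology modulo the remaining variables vanishes.
\<close>
lemma boundary_of_zigzag:
  "distinct xs \<Longrightarrow> zigzag xs v u \<Longrightarrow> u \<in> M \<Longrightarrow> boundary (set xs) (length xs) v"
proof (induction xs arbitrary: v)
  case Nil
  then have "aug v \<in> M" using ideal_add[OF M, of "aug v - u" u] by simp
  then obtain w where "\<forall>a<rk 0. v a = diff 0 w a" using aug_in_ideal_iff by blast
  then show ?case by (auto simp: boundary_def cong_mod_def var_ideal_empty)
next
  case (Cons x xs)
  let ?i = "length xs"
  from Cons.prems obtain y where
    y: "cong_mod (set xs) ?i (diff ?i v) (\<lambda>a. var x * y a)" "zigzag xs y u" and "distinct xs"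
    by auto
  with Cons.IH Cons.prems(3) obtain z where z: "cong_mod (set xs) ?i y (diff ?i z)"
    by (auto simp: boundary_def)
  have "cong_mod (set xs) ?i (diff ?i v) (\<lambda>a. var x * diff ?i z a)"
    using cong_mod_trans[OF y(1) cong_mod_scale[OF z]] .
  then have "cong_mod (set xs) ?i (diff ?i v - (\<lambda>a. var x * diff ?i z a))
      ((\<lambda>a. var x * diff ?i z a) - (\<lambda>a. var x * diff ?i z a))"
    by (rule cong_mod_minus) simp
  then have "cycle (set xs) (Suc ?i) (v - (\<lambda>a. var x * z a))"
    by (simp add: cycle_Suc diff_minus diff_scale zero_fun_def)
  then have "boundary (set xs) (Suc ?i) (v - (\<lambda>a. var x * z a))"
    by (intro acyclic_above \<open>distinct xs\<close>) auto
  then obtain w' where "cong_mod (set xs) (Suc ?i) (v - (\<lambda>a. var x * z a)) (diff (Suc ?i) w')"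
    by (auto simp: boundary_def)
  then have "cong_mod (set xs) (Suc ?i) (v - (\<lambda>a. var x * z a) + (\<lambda>a. var x * z a))
      (diff (Suc ?i) w' + (\<lambda>a. var x * z a))"
    by (rule cong_mod_add) simp
  then show ?case by (auto simp: boundary_insert)
qed

text \<open>
  The correspondence is well defined from homology to \<open>S/M\<close>. A boundary modulo \<open>(x, X)\<close> is a boundary
  plus \<open>x z\<close> modulo \<open>X\<close>. Its differential is \<open>x\<close> times that of \<open>z\<close>, so cancelling \<open>x\<close> shows that the
  element one position lower is a boundary again.
\<close>
lemma ideal_of_zigzag:
  "distinct xs \<Longrightarrow> zigzag xs v u \<Longrightarrow> boundary (set xs) (length xs) v \<Longrightarrow> u \<in> M"
proof (induction xs arbitrary: v)
  case Nil
  then have "aug v \<in> M" using aug_in_ideal_iff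
    by (auto simp: boundary_def cong_mod_def var_ideal_empty)
  with Nil show ?case using ideal_diff[OF M, of "aug v" "aug v - u"] by simp
next
  case (Cons x xs)
  let ?i = "length xs"
  from Cons.prems obtain y where
    y: "cong_mod (set xs) ?i (diff ?i v) (\<lambda>a. var x * y a)" "zigzag xs y u" and
    x: "x \<notin> set xs" "distinct xs"
    by auto
  from Cons.prems obtain w z where
    "cong_mod (set xs) (Suc ?i) v (diff (Suc ?i) w + (\<lambda>a. var x * z a))"
    by (auto simp: boundary_insert)
  then have 1: "cong_mod (set xs) ?i (diff ?i v) (diff ?i (diff (Suc ?i) w) + (\<lambda>a. var x * diff ?i z a))"
    using cong_mod_diff by (fastforce simp: diff_add diff_scale)
  have 2: "cong_mod (set xs) ?i (diff ?i (diff (Suc ?i) w) + (\<lambda>a. var x * diff ?i z a))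
      ((\<lambda>_. 0) + (\<lambda>a. var x * diff ?i z a))"
    by (intro cong_mod_add cong_mod_diff_diff cong_mod_refl)
  have "cong_mod (set xs) ?i (diff ?i v) (\<lambda>a. var x * diff ?i z a)"
    using cong_mod_trans[OF 1 2] by (simp add: plus_fun_def)
  then have "cong_mod (set xs) ?i (\<lambda>a. var x * y a) (\<lambda>a. var x * diff ?i z a)"
    using y(1) cong_mod_sym cong_mod_trans by blast
  then have "cong_mod (set xs) ?i y (diff ?i z)" by (rule cong_mod_cancel[OF x(1)])
  then have "boundary (set xs) ?i y" by (auto simp: boundary_def)
  with Cons.IH x y show ?case by blast
qed

text \<open>
  The differential of a cycle modulo \<open>(x, X)\<close> is divisible by \<open>x\<close> modulo \<open>X\<close>, and the quotient is
  again a cycle by regularity of \<open>x\<close>.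
\<close>
lemma zigzag_total: "distinct xs \<Longrightarrow> cycle (set xs) (length xs) v \<Longrightarrow> \<exists>u. zigzag xs v u"
proof (induction xs arbitrary: v)
  case Nil
  have "zigzag [] v (aug v)" by (simp add: ideal_zero[OF M])
  then show ?case ..
next
  case (Cons x xs)
  let ?i = "length xs"
  from Cons.prems have x: "x \<notin> set xs" "distinct xs" by auto
  from Cons.prems obtain y where
    "cong_mod (set xs) ?i (diff ?i v) ((\<lambda>_. 0) + (\<lambda>a. var x * y a))"
    by (auto simp: cycle_Suc cong_mod_insert)
  then have y: "cong_mod (set xs) ?i (diff ?i v) (\<lambda>a. var x * y a)"
    by (simp add: plus_fun_def)
  then have "cycle (set xs) ?i y" by (rule cycle_cancel[OF x(1)])
  with Cons.IH[OF x(2)] obtain u where "zigzag xs y u" by blast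
  with y show ?case by auto
qed

text \<open>
  A polynomial \<open>u\<close> multiplied into \<open>M\<close> by all of \<open>xs\<close> is hit: if \<open>v\<close> corresponds to \<open>u\<close> one step
  before, then \<open>x v\<close> corresponds to \<open>x u \<in> M\<close>, so \<open>x v\<close> is the boundary of an element that corresponds
  to \<open>u\<close>.
\<close>
lemma zigzag_surj:
  "distinct xs \<Longrightarrow> (\<And>x. x \<in> set xs \<Longrightarrow> var x * u \<in> M) \<Longrightarrow> \<exists>v. zigzag xs v u"
proof (induction xs)
  case Nil
  obtain v where "u - aug v \<in> M" using aug_surj by blast
  then have "aug v - u \<in> M"
    using ideal_mult[OF M, of "u - aug v" "-1"] by simp
  then show ?case by auto
next
  case (Cons x xs)
  let ?i = "length xs"
  from Cons obtain v where v: "zigzag xs v u" by auto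
  have "zigzag xs (\<lambda>a. var x * v a) (var x * u)" by (rule zigzag_scale[OF v])
  then have "boundary (set xs) ?i (\<lambda>a. var x * v a)"
    using boundary_of_zigzag Cons.prems by auto
  then obtain w where "cong_mod (set xs) ?i (diff ?i w) (\<lambda>a. var x * v a)"
    unfolding boundary_def by (blast dest: cong_mod_sym)
  with v show ?case by auto
qed

text \<open>
  If \<open>u\<close> corresponds to \<open>w\<close>, one step earlier it corresponds to some \<open>v\<close> such that \<open>x v\<close> is the
  boundary of \<open>w\<close>. As \<open>x v\<close> corresponds to \<open>x u\<close>, this puts \<open>x u\<close> into \<open>M\<close>.
\<close>
lemma zigzag_annihilates:
  "distinct xs \<Longrightarrow> zigzag xs v u \<Longrightarrow> x \<in> set xs \<Longrightarrow> var x * u \<in> M"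
proof (induction xs arbitrary: v)
  case (Cons y xs)
  let ?i = "length xs"
  from Cons.prems obtain w where
    w: "cong_mod (set xs) ?i (diff ?i v) (\<lambda>a. var y * w a)" "zigzag xs w u" and xs: "distinct xs"
    by auto
  show ?case
  proof (cases "x = y")
    case True
    have "boundary (set xs) ?i (\<lambda>a. var y * w a)"
      using cong_mod_sym[OF w(1)] by (auto simp: boundary_def)
    then show ?thesis using ideal_of_zigzag[OF xs zigzag_scale[OF w(2)]] True by blast
  qed (use Cons w xs in auto)
qed simp

text \<open>
  The degree \<open>j\<close> component of an element of \<open>F\<^sub>i\<close>, whose \<open>a\<close>-th basis element has degree
  \<open>degs i ! a\<close>.
\<close>
definition vec_comp :: "nat \<Rightarrow> int \<Rightarrow> (nat \<Rightarrow> ('n, 'k) mpol) \<Rightarrow> nat \<Rightarrow> ('n, 'k) mpol" where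
  "vec_comp i j v = (\<lambda>a. hom_comp (j - degs i ! a) (v a))"

lemma aug_vec_comp: "aug (vec_comp 0 j v) = hom_comp j (aug v)"
proof -
  have "homogeneous (e $ b) (degs 0 ! b)" if "b < rk 0" for b
    using res that by (simp add: minimal_graded_free_resolution_def)
  then show ?thesis
    unfolding aug_def vec_comp_def hom_comp_sum
    by (intro sum.cong refl) (metis hom_comp_mult lessThan_iff)
qed

lemma diff_vec_comp:
  assumes "a < rk i"
  shows "diff i (vec_comp (Suc i) j w) a = hom_comp (j - degs i ! a) (diff i w a)"
proof -
  have "homogeneous (d i $$ (a, b)) (degs (Suc i) ! b - degs i ! a)" if "b < rk (Suc i)" for b
    using res that assms by (simp add: minimal_graded_free_resolution_def graded_map_def)
  then show ?thesis
    unfolding diff_def vec_comp_def hom_comp_sum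
    by (intro sum.cong refl, subst hom_comp_mult[of _ "degs (Suc i) ! _ - degs i ! a"]) auto
qed

text \<open>
  Differentials preserve degrees and each division by a variable lowers them by one, so the
  correspondence is homogeneous of degree \<open>- length xs\<close>.
\<close>
lemma zigzag_comp: "zigzag xs v u \<Longrightarrow> zigzag xs (vec_comp (length xs) j v) (hom_comp (j - int (length xs)) u)"
proof (induction xs arbitrary: v j)
  case Nil
  then have "hom_comp j (aug v - u) \<in> M" by (simp add: hom_comp_in_monomial_ideal[OF M])
  then show ?case by (simp add: aug_vec_comp hom_comp_diff)
next
  case (Cons x xs)
  let ?i = "length xs"
  from Cons.prems obtain y where
    y: "cong_mod (set xs) ?i (diff ?i v) (\<lambda>a. var x * y a)" "zigzag xs y u"
    by auto
  have "cong_mod (set xs) ?i (diff ?i (vec_comp (Suc ?i) j v)) (\<lambda>a. var x * vec_comp ?i (j - 1) y a)"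
    unfolding cong_mod_def
  proof (intro allI impI)
    fix a assume a: "a < rk ?i"
    have "hom_comp (j - degs ?i ! a) (diff ?i v a - var x * y a) \<in> var_ideal (set xs)"
      using y(1) a by (intro hom_comp_var_ideal) (auto simp: cong_mod_def)
    moreover have "j - degs ?i ! a - 1 = j - 1 - degs ?i ! a" by simp
    ultimately show "diff ?i (vec_comp (Suc ?i) j v) a - var x * vec_comp ?i (j - 1) y a
        \<in> var_ideal (set xs)"
      using a by (simp add: diff_vec_comp hom_comp_diff hom_comp_mult[OF homogeneous_var])
        (simp add: vec_comp_def)
  qed
  moreover have "zigzag xs (vec_comp ?i (j - 1) y) (hom_comp (j - 1 - int ?i) u)"
    by (rule Cons.IH[OF y(2)])
  moreover have "j - 1 - int ?i = j - int (length (x # xs))" by simp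
  ultimately show ?case by auto
qed

lemma lookup_d_zero: "a < rk i \<Longrightarrow> b < rk (Suc i) \<Longrightarrow> Poly_Mapping.lookup (d i $$ (a, b)) 0 = 0"
  using res by (simp add: minimal_graded_free_resolution_def)

lemma diff_in_max_ideal: "a < rk i \<Longrightarrow> diff i w a \<in> var_ideal UNIV"
  unfolding diff_def
proof (rule var_ideal_sum)
  fix b assume "a < rk i" "b \<in> {..<rk (Suc i)}"
  then have "d i $$ (a, b) \<in> var_ideal UNIV" by (simp add: var_ideal_UNIV lookup_d_zero)
  then show "d i $$ (a, b) * w b \<in> var_ideal UNIV"
    using var_ideal_mult by (metis mult.commute)
qed

lemma cycle_UNIV: "cycle UNIV i v"
  by (auto simp: cycle_def cong_mod_def intro: diff_in_max_ideal)

text \<open>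
  By minimality the differentials vanish modulo the maximal ideal, so an element of \<open>F\<^sub>i\<close> represents
  zero in homology iff all its entries lie in the maximal ideal.
\<close>
lemma boundary_UNIV: "boundary UNIV i v \<longleftrightarrow> (\<forall>a<rk i. Poly_Mapping.lookup (v a) 0 = 0)"
proof
  assume "boundary UNIV i v"
  then obtain w where w: "\<And>a. a < rk i \<Longrightarrow> v a - diff i w a \<in> var_ideal UNIV"
    by (auto simp: boundary_def cong_mod_def)
  have "v a - diff i w a + diff i w a \<in> var_ideal UNIV" if "a < rk i" for a
    using w that diff_in_max_ideal var_ideal_add by blast
  then show "\<forall>a<rk i. Poly_Mapping.lookup (v a) 0 = 0" by (simp add: var_ideal_UNIV)
next
  assume "\<forall>a<rk i. Poly_Mapping.lookup (v a) 0 = 0"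
  then have "cong_mod UNIV i v (diff i (\<lambda>_. 0))" by (simp add: cong_mod_def var_ideal_UNIV)
  then show "boundary UNIV i v" unfolding boundary_def by blast
qed

text \<open>
  Once all variables are killed, \<open>F\<^sub>n / (x\<^sub>1, \<dots>, x\<^sub>n) F\<^sub>n\<close> corresponds to the socle. Choose
  homogeneous polynomials corresponding to the basis elements of degree \<open>j\<close>, and homogeneous
  vectors corresponding to the socle monomials of degree \<open>j - n\<close>. Reading off the coefficients at the
  socle monomials, respectively the constant terms at the basis elements of degree \<open>j\<close>, gives
  two matrices with independent columns, hence both inequalities between the two numbers.
\<close>
theorem top_degrees:
  fixes j :: int
  defines "T \<equiv> {t \<in> socle_mons M. int (mdeg t) + int CARD('n) = j}"
  shows "finite T" "count_list (degs CARD('n)) j = card T"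
proof -
  obtain xs :: "'n list" where xs: "set xs = UNIV" "distinct xs"
    using finite_distinct_list[of "UNIV :: 'n set"] by auto
  then have len: "length xs = CARD('n)" by (metis distinct_card)
  define n where "n = CARD('n)"
  have ideal_iff: "u \<in> M \<longleftrightarrow> (\<forall>a<rk n. Poly_Mapping.lookup (v a) 0 = 0)" if "zigzag xs v u" for v u
    using ideal_of_zigzag[OF xs(2) that] boundary_of_zigzag[OF xs(2) that] boundary_UNIV
    by (auto simp: xs(1) len n_def)
  define J where "J = {b. b < rk n \<and> degs n ! b = j}"
  have finJ: "finite J" by (simp add: J_def)
  have cJ: "count_list (degs n) j = card J"
    by (simp add: J_def count_list_eq_length_filter length_filter_conv_card eq_commute[of j])
  define cst :: "'k \<Rightarrow> ('n, 'k) mpol" where "cst = Poly_Mapping.single 0"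
  have lookup_cst: "Poly_Mapping.lookup (cst c * p) t = c * Poly_Mapping.lookup p t" for c p t
    by (simp add: cst_def lookup_single_mult)

  have "\<exists>u. zigzag xs (\<lambda>a. if a = b then 1 else 0) u \<and> hom_comp (j - int n) u = u" if b: "b \<in> J" for b
  proof -
    let ?v = "\<lambda>a. if a = b then 1 else 0 :: ('n, 'k) mpol"
    obtain u where "zigzag xs ?v u" using zigzag_total[OF xs(2)] cycle_UNIV xs(1) by metis
    then have "zigzag xs (vec_comp n j ?v) (hom_comp (j - int n) u)"
      using zigzag_comp len n_def by metis
    moreover have "hom_comp 0 (1 :: ('n, 'k) mpol) = 1"
      by (rule poly_mapping_eqI) (auto simp: lookup_hom_comp lookup_one when_def)
    then have "vec_comp n j ?v = ?v" using b by (auto simp: vec_comp_def J_def fun_eq_iff)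
    moreover have "hom_comp (j - int n) (hom_comp (j - int n) u) = hom_comp (j - int n) u"
      by (rule poly_mapping_eqI) (simp add: lookup_hom_comp)
    ultimately show ?thesis by metis
  qed
  then obtain U where U: "\<And>b. b \<in> J \<Longrightarrow> zigzag xs (\<lambda>a. if a = b then 1 else 0) (U b)"
    "\<And>b. b \<in> J \<Longrightarrow> hom_comp (j - int n) (U b) = U b" by metis

  have "\<exists>v. zigzag xs v (monom_poly t) \<and> vec_comp n j v = v" if t: "t \<in> T" for t
  proof -
    have "var x * monom_poly t \<in> M" for x
      using t by (auto simp: T_def socle_mons_def mons_def monom_poly_def mult_single add.commute)
    then obtain v where "zigzag xs v (monom_poly t)" using zigzag_surj[OF xs(2)] by blast
    then have "zigzag xs (vec_comp n j v) (hom_comp (j - int n) (monom_poly t))"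
      using zigzag_comp len n_def by metis
    moreover have "hom_comp (j - int n) (monom_poly t) = (monom_poly t :: ('n, 'k) mpol)"
      using t by (intro poly_mapping_eqI)
        (auto simp: lookup_hom_comp monom_poly_def T_def n_def lookup_single when_def)
    moreover have "vec_comp n j (vec_comp n j v) = vec_comp n j v"
      by (auto simp: vec_comp_def fun_eq_iff lookup_hom_comp intro!: poly_mapping_eqI)
    ultimately show ?thesis by metis
  qed
  then obtain V where V: "\<And>t. t \<in> T \<Longrightarrow> zigzag xs (V t) (monom_poly t)"
    "\<And>t. t \<in> T \<Longrightarrow> vec_comp n j (V t) = V t" by metis

  have fc: "finite T \<and> card T \<le> card J"
  proof (rule card_le_if_trivial_kernel[OF finJ])
    fix S and c :: "'n mon \<Rightarrow> 'k"
    assume S: "finite S" "S \<subseteq> T"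
      and z: "\<And>b. b \<in> J \<Longrightarrow> (\<Sum>t\<in>S. c t * Poly_Mapping.lookup (V t b) 0) = 0"
    have "zigzag xs (\<Sum>t\<in>S. (\<lambda>a. cst (c t) * V t a)) (\<Sum>t\<in>S. cst (c t) * monom_poly t)"
      using S V(1) by (intro zigzag_sum zigzag_scale) auto
    moreover have "Poly_Mapping.lookup ((\<Sum>t\<in>S. (\<lambda>a. cst (c t) * V t a)) b) 0 = 0"
      if b: "b < rk n" for b
    proof (cases "b \<in> J")
      case True
      with z show ?thesis by (simp add: fun_sum_apply lookup_sum lookup_cst)
    next
      case False
      have "Poly_Mapping.lookup (V t b) 0 = 0" if "t \<in> S" for t
      proof -
        have "V t b = hom_comp (j - degs n ! b) (V t b)"
          using V(2)[of t] that S(2) by (auto simp: vec_comp_def fun_eq_iff)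
        then have "Poly_Mapping.lookup (V t b) 0 = Poly_Mapping.lookup (hom_comp (j - degs n ! b) (V t b)) 0"
          by simp
        then show ?thesis using False b by (simp add: lookup_hom_comp J_def)
      qed
      then show ?thesis by (simp add: fun_sum_apply lookup_sum lookup_cst)
    qed
    ultimately have inM: "(\<Sum>t\<in>S. cst (c t) * monom_poly t) \<in> M" using ideal_iff by blast
    show "\<forall>t\<in>S. c t = 0"
    proof (rule ballI, rule ccontr)
      fix t assume t: "t \<in> S" "c t \<noteq> 0"
      have "Poly_Mapping.lookup (\<Sum>t\<in>S. cst (c t) * monom_poly t) t = (\<Sum>s\<in>S. if s = t then c s else 0)"
        unfolding lookup_sum lookup_cst monom_poly_def
        by (rule sum.cong) (auto simp: lookup_single when_def)
      also have "\<dots> = c t" using t S by simp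
      finally have "Poly_Mapping.lookup (\<Sum>t\<in>S. cst (c t) * monom_poly t) t = c t" .
      with t have "t \<in> mons M" using inM in_monomial_ideal_iff[OF M] by (metis in_keys_iff)
      with t S show False by (auto simp: T_def socle_mons_def)
    qed
  qed
  then show "finite T" ..
  have "finite J \<and> card J \<le> card T"
  proof (rule card_le_if_trivial_kernel)
    show "finite T" using fc ..
    fix S and c :: "nat \<Rightarrow> 'k"
    assume S: "finite S" "S \<subseteq> J"
      and z: "\<And>t. t \<in> T \<Longrightarrow> (\<Sum>b\<in>S. c b * Poly_Mapping.lookup (U b) t) = 0"
    let ?v = "\<Sum>b\<in>S. (\<lambda>a. cst (c b) * (if a = b then 1 else 0))"
    let ?u = "\<Sum>b\<in>S. cst (c b) * U b"
    have r: "zigzag xs ?v ?u"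
      using S U(1) by (intro zigzag_sum zigzag_scale) auto
    have "?u \<in> M" unfolding in_monomial_ideal_iff[OF M]
    proof (rule ballI, rule ccontr)
      fix t assume t: "t \<in> Poly_Mapping.keys ?u" "t \<notin> mons M"
      have u: "Poly_Mapping.lookup ?u t = (\<Sum>b\<in>S. c b * Poly_Mapping.lookup (U b) t)"
        by (simp add: lookup_sum lookup_cst)
      have "int (mdeg t) = j - int n"
      proof (rule ccontr)
        assume ne: "int (mdeg t) \<noteq> j - int n"
        have "Poly_Mapping.lookup (U b) t = 0" if "b \<in> S" for b
          using lookup_hom_comp[of "j - int n" "U b" t] U(2)[of b] that S(2) ne by auto
        with u t(1) show False by (simp add: in_keys_iff)
      qed
      moreover have "t + expo x \<in> mons M" for x
      proof -
        have u: "var x * ?u \<in> M" using zigzag_annihilates[OF xs(2) r] xs(1) by blast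
        have "Poly_Mapping.lookup (var x * ?u) (t + expo x) = Poly_Mapping.lookup ?u t"
          by (simp add: lookup_var_mult lookup_add)
        then have "t + expo x \<in> Poly_Mapping.keys (var x * ?u)"
          using t(1) unfolding in_keys_iff by simp
        with u show ?thesis unfolding in_monomial_ideal_iff[OF M] by (rule bspec)
      qed
      ultimately have "t \<in> T" using t(2) by (simp add: T_def socle_mons_def n_def)
      with z u t(1) show False by (simp add: in_keys_iff)
    qed
    then have zero: "Poly_Mapping.lookup (?v a) 0 = 0" if "a < rk n" for a using ideal_iff[OF r] that by blast
    show "\<forall>b\<in>S. c b = 0"
    proof
      fix b assume b: "b \<in> S"
      have "Poly_Mapping.lookup (?v b) 0 = (\<Sum>i\<in>S. if i = b then c i else 0)"
        unfolding fun_sum_apply lookup_sum lookup_cst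
        by (rule sum.cong) (auto simp: lookup_one)
      also have "\<dots> = c b" using S(1) b by simp
      finally show "c b = 0" using zero[of b] b S(2) by (auto simp: J_def)
    qed
  qed
  with fc cJ show "count_list (degs CARD('n)) j = card T" by (simp add: n_def)
qed

corollary top_rank: "length (degs CARD('n)) = card (socle_mons M)"
proof -
  let ?T = "\<lambda>j. {t \<in> socle_mons M. int (mdeg t) + int CARD('n) = j}"
  have "j \<in> set (degs CARD('n))" if "t \<in> ?T j" for t j
  proof (rule ccontr)
    assume "j \<notin> set (degs CARD('n))"
    then have "card (?T j) = 0" using top_degrees(2)[of j] by (simp add: count_notin)
    then show False using top_degrees(1)[of j] that by (simp only: card_eq_0_iff) blast
  qed
  then have soc: "socle_mons M = (\<Union>j\<in>set (degs CARD('n)). ?T j)" by auto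
  have "length (degs CARD('n)) = (\<Sum>j\<in>set (degs CARD('n)). count_list (degs CARD('n)) j)"
    by (simp add: sum_count_set)
  also have "\<dots> = (\<Sum>j\<in>set (degs CARD('n)). card (?T j))"
    by (simp add: top_degrees(2))
  also have "\<dots> = card (\<Union>j\<in>set (degs CARD('n)). ?T j)"
    by (rule card_UN_disjoint[symmetric]) (auto simp: top_degrees(1))
  finally show ?thesis using soc by simp
qed

end

section \<open>Dickson's lemma\<close>

text \<open>
  The indices after which the sequence never drops below its current value are infinitely many.
\<close>
lemma nondecreasing_subsequence:
  fixes s :: "nat \<Rightarrow> nat"
  obtains r :: "nat \<Rightarrow> nat" where "strict_mono r" "\<And>i j. i \<le> j \<Longrightarrow> s (r i) \<le> s (r j)"
proof -
  define S where "S = {i. \<forall>j\<ge>i. s i \<le> s j}"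
  have "\<exists>i>k. i \<in> S" for k
  proof -
    obtain i where i: "i > k" "\<And>j. j > k \<Longrightarrow> s i \<le> s j"
      using ex_has_least_nat[of "\<lambda>i. i > k" "Suc k" s] by auto
    then have "i \<in> S" by (auto simp: S_def)
    with i(1) show ?thesis by blast
  qed
  then have inf: "infinite S" by (simp add: infinite_nat_iff_unbounded)
  show thesis
  proof (rule that[of "enumerate S"])
    show "strict_mono (enumerate S)" by (rule strict_mono_enumerate[OF inf])
    fix i j :: nat assume "i \<le> j"
    then have "enumerate S i \<le> enumerate S j"
      using strict_mono_enumerate[OF inf] by (simp add: strict_mono_less_eq)
    then show "s (enumerate S i) \<le> s (enumerate S j)"
      using enumerate_in_set[OF inf, of i] by (auto simp: S_def)
  qed
qed

text \<open>
  Refine to a nondecreasing subsequence for one variable after the other.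
\<close>
lemma dickson:
  fixes f :: "nat \<Rightarrow> 'n::finite mon"
  shows "\<exists>i j. i < j \<and> mon_le (f i) (f j)"
proof -
  define ascending :: "(nat \<Rightarrow> nat) \<Rightarrow> 'n \<Rightarrow> bool" where
    "ascending r x \<longleftrightarrow> (\<forall>i j. i \<le> j \<longrightarrow>
      Poly_Mapping.lookup (f (r i)) x \<le> Poly_Mapping.lookup (f (r j)) x)" for r x
  have "\<exists>r :: nat \<Rightarrow> nat. strict_mono r \<and> (\<forall>x\<in>X. ascending r x)" if "finite X" for X
    using that
  proof induction
    case empty
    show ?case using strict_mono_id by blast
  next
    case (insert x X)
    then obtain r :: "nat \<Rightarrow> nat" where r: "strict_mono r" "\<forall>x\<in>X. ascending r x" by blast
    obtain q :: "nat \<Rightarrow> nat" where q: "strict_mono q" "\<And>i j. i \<le> j \<Longrightarrow>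
        Poly_Mapping.lookup (f (r (q i))) x \<le> Poly_Mapping.lookup (f (r (q j))) x"
      by (rule nondecreasing_subsequence[of "\<lambda>i. Poly_Mapping.lookup (f (r i)) x"]) blast
    have "strict_mono (r \<circ> q)" using r(1) q(1) by (rule strict_mono_o)
    moreover have "ascending (r \<circ> q) y" if "y \<in> X" for y
      using r(2) that q(1) by (simp add: ascending_def strict_mono_less_eq)
    moreover have "ascending (r \<circ> q) x" using q(2) by (simp add: ascending_def)
    ultimately show ?case by blast
  qed
  then obtain r :: "nat \<Rightarrow> nat" where r: "strict_mono r" "\<And>x. ascending r x"
    by (meson UNIV_I finite)
  have "r 0 < r 1" using r(1) by (simp add: strict_mono_def)
  moreover have "mon_le (f (r 0)) (f (r 1))" using r(2) by (simp add: ascending_def mon_le_def)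
  ultimately show ?thesis by blast
qed

lemma finite_min_gens:
  fixes M :: "('n::finite, 'k::field) mpol set"
  assumes "monomial_ideal M"
  shows "finite (min_gens M)"
proof (rule ccontr)
  assume "infinite (min_gens M)"
  then obtain f :: "nat \<Rightarrow> 'n mon" where f: "inj f" "range f \<subseteq> min_gens M"
    using infinite_countable_subset by blast
  obtain i j where ij: "i < j" "mon_le (f i) (f j)" using dickson by blast
  moreover have "f i \<in> min_gens M" "f j \<in> min_gens M" using f(2) by auto
  ultimately have "f i = f j" using min_gens_eq[OF assms] by auto
  with f(1) ij(1) show False by (simp add: inj_eq)
qed

section \<open>Minimal generators of multigraded families of spaces\<close>

text \<open>
  A map of multigraded free modules is given by a list with one entry per basis element of the source:
  its multidegree and its column of scalar coefficients. The power of the variables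
  accompanying a coefficient is determined by the multidegrees.
\<close>
type_synonym ('n, 'k) family = "('n mon \<times> (nat \<Rightarrow> 'k)) list"

definition comb :: "('n, 'k::field) family \<Rightarrow> (nat \<Rightarrow> 'k) \<Rightarrow> nat \<Rightarrow> 'k" where
  "comb F \<mu> = (\<lambda>a. \<Sum>b<length F. \<mu> b * snd (F ! b) a)"

text \<open>
  In multidegree \<open>t\<close> the free module with multidegrees \<open>map fst F\<close> is the space of the vectors
  supported on the basis elements whose multidegree divides \<open>t\<close>.
\<close>
definition supp_le :: "('n, 'k::field) family \<Rightarrow> 'n mon \<Rightarrow> (nat \<Rightarrow> 'k) \<Rightarrow> bool" where
  "supp_le F t \<mu> \<longleftrightarrow> (\<forall>b. \<mu> b \<noteq> 0 \<longrightarrow> b < length F \<and> mon_le (fst (F ! b)) t)"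

text \<open>
  The columns generate a submodule with multigraded pieces \<open>K t\<close>. The last condition is
  minimality: a relation in the multidegree of a generator never involves that generator with a
  nonzero, hence invertible, coefficient.
\<close>
definition min_generates :: "('n, 'k::field) family \<Rightarrow> ('n mon \<Rightarrow> (nat \<Rightarrow> 'k) set) \<Rightarrow> bool" where
  "min_generates F K \<longleftrightarrow>
    (\<forall>b<length F. snd (F ! b) \<in> K (fst (F ! b))) \<and>
    (\<forall>t. \<forall>v\<in>K t. \<exists>\<mu>. supp_le F t \<mu> \<and> v = comb F \<mu>) \<and>
    (\<forall>b<length F. \<forall>\<mu>. supp_le F (fst (F ! b)) \<mu> \<longrightarrow> comb F \<mu> = (\<lambda>_. 0) \<longrightarrow> \<mu> b = 0)"

definition syzygies :: "('n, 'k::field) family \<Rightarrow> 'n mon \<Rightarrow> (nat \<Rightarrow> 'k) set" where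
  "syzygies F t = {\<mu>. supp_le F t \<mu> \<and> comb F \<mu> = (\<lambda>_. 0)}"

text \<open>
  The multigraded pieces of a submodule of a free module of rank \<open>m\<close>, identified with spaces of scalar
  vectors: multiplication by monomials becomes inclusion. The pieces are
  generated from the finitely many multidegrees in \<open>B\<close>.
\<close>
locale filtered_space =
  fixes K :: "'n mon \<Rightarrow> (nat \<Rightarrow> 'k::field) set" and m :: nat and B :: "'n mon set"
  assumes zero: "(\<lambda>_. 0) \<in> K t"
    and add: "v \<in> K t \<Longrightarrow> w \<in> K t \<Longrightarrow> (\<lambda>a. v a + w a) \<in> K t"
    and scale: "v \<in> K t \<Longrightarrow> (\<lambda>a. c * v a) \<in> K t"
    and bounded: "v \<in> K t \<Longrightarrow> a \<ge> m \<Longrightarrow> v a = 0"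
    and mono: "mon_le s t \<Longrightarrow> K s \<subseteq> K t"
    and finB: "finite B"
    and jumps: "\<exists>s\<in>B. mon_le s t \<and> K t \<subseteq> K s"
begin

lemma sum_mem: "(\<And>i. i \<in> I \<Longrightarrow> c i \<noteq> 0 \<Longrightarrow> v i \<in> K t) \<Longrightarrow> (\<lambda>a. \<Sum>i\<in>I. c i * v i a) \<in> K t"
proof (induction I rule: infinite_finite_induct)
  case (insert i I)
  have "(\<lambda>a. c i * v i a) \<in> K t"
    using insert.prems[of i] scale zero by (cases "c i = 0") auto
  then have "(\<lambda>a. c i * v i a + (\<Sum>i\<in>I. c i * v i a)) \<in> K t"
    using insert by (intro add) auto
  then show ?case using insert(1,2) by simp
qed (simp_all add: zero)

definition generating :: "('n mon \<times> (nat \<Rightarrow> 'k)) set \<Rightarrow> bool" where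
  "generating P \<longleftrightarrow> finite P \<and> (\<forall>(s, v)\<in>P. v \<in> K s) \<and>
    (\<forall>t. \<forall>v\<in>K t. \<exists>\<mu>. (\<forall>p\<in>P. \<mu> p \<noteq> 0 \<longrightarrow> mon_le (fst p) t) \<and> v = (\<lambda>a. \<Sum>p\<in>P. \<mu> p * snd p a))"

lemma finite_spanning_set:
  "\<exists>E. finite E \<and> E \<subseteq> K s \<and> (\<forall>v\<in>K s. \<exists>c. v = (\<lambda>a. \<Sum>u\<in>E. c u * u a))"
proof -
  interpret fun_space: vector_space "\<lambda>(c::'k::field) (f :: nat \<Rightarrow> 'k) x. c * f x"
    by (rule vector_space_fun)
  obtain E where E: "E \<subseteq> K s" "fun_space.independent E" "K s \<subseteq> fun_space.span E"
    using fun_space.maximal_independent_subset by blast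
  have "E \<subseteq> fun_space.span ((\<lambda>t. (\<lambda>s. if s = t then 1 else 0)) ` {..<m})"
  proof
    fix v assume "v \<in> E"
    then have "v t = 0" if "t \<notin> {..<m}" for t using E(1) that bounded[of v s t] by auto
    then show "v \<in> fun_space.span ((\<lambda>t. (\<lambda>s. if s = t then 1 else 0)) ` {..<m})"
      by (intro finite_support_in_span) auto
  qed
  then have fin: "finite E"
    using fun_space.independent_span_bound[OF _ E(2)] by blast
  have "\<exists>c. v = (\<lambda>a. \<Sum>u\<in>E. c u * u a)" if "v \<in> K s" for v
  proof -
    from that E(3) have "v \<in> range (\<lambda>c. \<Sum>u\<in>E. (\<lambda>x. c u * u x))"
      unfolding fun_space.span_finite[OF fin, symmetric] by blast
    then obtain c where "v = (\<Sum>u\<in>E. (\<lambda>x. c u * u x))" by blast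
    then have "v = (\<lambda>a. \<Sum>u\<in>E. c u * u a)" by (auto simp: fun_sum_apply)
    then show ?thesis by blast
  qed
  with fin E(1) show ?thesis by blast
qed

text \<open>
  Take a basis of \<open>K s\<close> for each \<open>s \<in> B\<close>.
\<close>
lemma exists_generating: "\<exists>P. generating P"
proof -
  obtain E where E_all: "\<forall>s. finite (E s) \<and> E s \<subseteq> K s \<and> (\<forall>v\<in>K s. \<exists>c. v = (\<lambda>a. \<Sum>u\<in>E s. c u * u a))"
    by (rule exE[OF choice[OF allI[OF finite_spanning_set]]])
  then have E: "finite (E s)" "E s \<subseteq> K s"
    "v \<in> K s \<Longrightarrow> \<exists>c. v = (\<lambda>a. \<Sum>u\<in>E s. c u * u a)" for s v
    by auto
  have fin: "finite (Sigma B E)" using finB E(1) by (rule finite_SigmaI)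
  have "\<exists>\<mu>. (\<forall>p\<in>Sigma B E. \<mu> p \<noteq> 0 \<longrightarrow> mon_le (fst p) t) \<and> v = (\<lambda>a. \<Sum>p\<in>Sigma B E. \<mu> p * snd p a)"
    if "v \<in> K t" for t v
  proof -
    obtain s where s: "s \<in> B" "mon_le s t" "K t \<subseteq> K s" using jumps[of t] by blast
    with that obtain c where c: "v = (\<lambda>a. \<Sum>u\<in>E s. c u * u a)" using E(3)[of v s] by auto
    define \<mu> where "\<mu> = (\<lambda>p. if fst p = s then c (snd p) else 0)"
    have "(\<Sum>p\<in>Sigma B E. \<mu> p * snd p a) = (\<Sum>u\<in>E s. c u * u a)" for a
    proof -
      have "(\<Sum>p\<in>Sigma B E. \<mu> p * snd p a) = (\<Sum>r\<in>B. \<Sum>u\<in>E r. \<mu> (r, u) * u a)"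
        using finB E(1) by (simp add: sum.Sigma case_prod_unfold)
      also have "\<dots> = (\<Sum>r\<in>B. if r = s then \<Sum>u\<in>E s. c u * u a else 0)"
        by (rule sum.cong) (auto simp: \<mu>_def)
      also have "\<dots> = (\<Sum>u\<in>E s. c u * u a)" using finB s(1) by simp
      finally show ?thesis .
    qed
    with c s(2) show ?thesis by (intro exI[of _ \<mu>]) (auto simp: \<mu>_def)
  qed
  with fin E(2) show ?thesis unfolding generating_def by (intro exI[of _ "Sigma B E"]) auto
qed

text \<open>
  In a generating set of least size, a relation with nonzero coefficient at a generator \<open>p\<close> would allow
  every representation to be rewritten without \<open>p\<close>, so \<open>p\<close> could be removed.
\<close>
lemma exists_min_generates: "\<exists>F. min_generates F K"
proof -
  obtain P where P: "generating P" and least: "\<And>Q. generating Q \<Longrightarrow> card P \<le> card Q"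
    using exists_generating ex_has_least_nat[of generating _ card] by blast
  have finP: "finite P" using P by (simp add: generating_def)
  have irredundant: "\<mu> p = 0"
    if p: "p \<in> P" and \<mu>: "\<And>q. q \<in> P \<Longrightarrow> \<mu> q \<noteq> 0 \<Longrightarrow> mon_le (fst q) (fst p)"
      "\<And>a. (\<Sum>q\<in>P. \<mu> q * snd q a) = 0" for p \<mu>
  proof (rule ccontr)
    assume nz: "\<mu> p \<noteq> 0"
    have "generating (P - {p})"
      unfolding generating_def
    proof (intro conjI allI ballI)
      show "finite (P - {p})" using finP by simp
      show "case q of (s, v) \<Rightarrow> v \<in> K s" if "q \<in> P - {p}" for q
        using P that by (auto simp: generating_def)
      fix t v assume "v \<in> K t"
      then obtain \<nu> where \<nu>: "\<And>q. q \<in> P \<Longrightarrow> \<nu> q \<noteq> 0 \<Longrightarrow> mon_le (fst q) t"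
        "v = (\<lambda>a. \<Sum>q\<in>P. \<nu> q * snd q a)"
        using P unfolding generating_def by meson
      define \<nu>' where "\<nu>' q = \<nu> q - \<nu> p / \<mu> p * \<mu> q" for q
      have p0: "\<nu>' p = 0" using nz by (simp add: \<nu>'_def)
      have "(\<Sum>q\<in>P - {p}. \<nu>' q * snd q a) = (\<Sum>q\<in>P. \<nu> q * snd q a)" for a
      proof -
        have "(\<Sum>q\<in>P - {p}. \<nu>' q * snd q a) = (\<Sum>q\<in>P. \<nu>' q * snd q a)"
          using finP p p0 by (simp add: sum.remove)
        also have "\<dots> = (\<Sum>q\<in>P. \<nu> q * snd q a) - \<nu> p / \<mu> p * (\<Sum>q\<in>P. \<mu> q * snd q a)"
          by (simp add: \<nu>'_def left_diff_distrib sum_subtractf sum_distrib_left mult.assoc)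
        finally show ?thesis by (simp add: \<mu>(2))
      qed
      moreover have "mon_le (fst q) t" if q: "q \<in> P - {p}" "\<nu>' q \<noteq> 0" for q
      proof (cases "\<nu> q = 0")
        case True
        then have "\<nu> p \<noteq> 0" "\<mu> q \<noteq> 0" using q(2) by (auto simp: \<nu>'_def)
        then show ?thesis using \<nu>(1) \<mu>(1) p q mon_le_trans by blast
      qed (use q \<nu>(1) in auto)
      ultimately show "\<exists>\<mu>. (\<forall>q\<in>P - {p}. \<mu> q \<noteq> 0 \<longrightarrow> mon_le (fst q) t) \<and>
          v = (\<lambda>a. \<Sum>q\<in>P - {p}. \<mu> q * snd q a)"
        using \<nu>(2) by (intro exI[of _ \<nu>']) auto
    qed
    then have "card P \<le> card (P - {p})" by (rule least)
    then show False using finP p by (metis card_Diff1_less not_le)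
  qed
  obtain F where F: "set F = P" "distinct F" using finP finite_distinct_list by blast
  have inj: "inj_on ((!) F) {..<length F}" using F(2) by (auto simp: inj_on_def nth_eq_iff_index_eq)
  have img: "(!) F ` {..<length F} = P" unfolding F(1)[symmetric] set_conv_nth by blast
  have sum_eq: "(\<Sum>p\<in>P. f p) = (\<Sum>b<length F. f (F ! b))" for f :: "_ \<Rightarrow> 'k"
    unfolding img[symmetric] by (simp add: sum.reindex[OF inj])
  have "min_generates F K"
    unfolding min_generates_def
  proof (intro conjI allI impI ballI)
    show "snd (F ! b) \<in> K (fst (F ! b))" if "b < length F" for b
      using P F(1) nth_mem[OF that] by (auto simp: generating_def case_prod_unfold)
  next
    fix t v assume "v \<in> K t"
    then obtain \<mu> where \<mu>: "\<And>p. p \<in> P \<Longrightarrow> \<mu> p \<noteq> 0 \<Longrightarrow> mon_le (fst p) t"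
      "v = (\<lambda>a. \<Sum>p\<in>P. \<mu> p * snd p a)"
      using P unfolding generating_def by meson
    define \<nu> where "\<nu> b = (if b < length F then \<mu> (F ! b) else 0)" for b
    have "supp_le F t \<nu>" using \<mu>(1) F(1) nth_mem[of _ F] by (simp add: supp_le_def \<nu>_def)
    moreover have "v = comb F \<nu>" by (auto simp: \<mu>(2) comb_def sum_eq \<nu>_def)
    ultimately show "\<exists>\<mu>. supp_le F t \<mu> \<and> v = comb F \<mu>" by blast
  next
    fix b \<mu> assume b: "b < length F" "supp_le F (fst (F ! b)) \<mu>" "comb F \<mu> = (\<lambda>_. 0)"
    define \<nu> where "\<nu> p = \<mu> (inv_into {..<length F} ((!) F) p)" for p
    have \<nu>: "\<nu> (F ! c) = \<mu> c" if "c < length F" for c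
      using inv_into_f_f[OF inj] that by (simp add: \<nu>_def)
    have "\<nu> (F ! b) = 0"
    proof (rule irredundant)
      show "F ! b \<in> P" using b(1) F(1) by auto
      show "mon_le (fst q) (fst (F ! b))" if "q \<in> P" "\<nu> q \<noteq> 0" for q
        using that b(2) \<nu> unfolding img[symmetric] by (auto simp: supp_le_def)
      show "(\<Sum>q\<in>P. \<nu> q * snd q a) = 0" for a
        using b(3) by (simp add: sum_eq \<nu> comb_def fun_eq_iff)
    qed
    then show "\<mu> b = 0" using \<nu> b(1) by simp
  qed
  then show ?thesis ..
qed

end

lemma mon_lcm_le_iff:
  assumes "finite D"
  shows "mon_le (mon_lcm D) t \<longleftrightarrow> (\<forall>m\<in>D. mon_le m t)"
  using assms by (auto simp: mon_le_def lookup_mon_lcm)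

lemma supp_le_mono: "supp_le F s \<mu> \<Longrightarrow> mon_le s t \<Longrightarrow> supp_le F t \<mu>"
  unfolding supp_le_def using mon_le_trans by blast

lemma comb_add: "comb F (\<lambda>b. \<mu> b + \<nu> b) = (\<lambda>a. comb F \<mu> a + comb F \<nu> a)"
  by (simp add: comb_def distrib_right sum.distrib)

lemma comb_scale: "comb F (\<lambda>b. c * \<mu> b) = (\<lambda>a. c * comb F \<mu> a)"
  by (simp add: comb_def sum_distrib_left mult.assoc)

lemma comb_zero: "comb F (\<lambda>_. 0) = (\<lambda>_. 0)"
  by (simp add: comb_def)

text \<open>
  The kernel in multidegree \<open>t\<close> depends only on the set of generators whose multidegree divides
  \<open>t\<close>. The same set divides its own lcm, so kernels need only be considered at
  the lcms of the multidegrees.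
\<close>
lemma syzygies_filtered:
  fixes F :: "('n::finite, 'k::field) family"
  shows "filtered_space (syzygies F) (length F) (mon_lcm ` Pow (set (map fst F)))"
proof
  fix s t :: "'n mon" and v w :: "nat \<Rightarrow> 'k" and c :: 'k and a :: nat
  show "(\<lambda>_. 0) \<in> syzygies F t" by (simp add: syzygies_def supp_le_def comb_zero)
  show "(\<lambda>a. v a + w a) \<in> syzygies F t" if "v \<in> syzygies F t" "w \<in> syzygies F t"
    using that by (auto simp: syzygies_def comb_add supp_le_def) (metis add.right_neutral)+
  show "(\<lambda>a. c * v a) \<in> syzygies F t" if "v \<in> syzygies F t"
    using that by (auto simp: syzygies_def comb_scale supp_le_def)
  show "v a = 0" if "v \<in> syzygies F t" "a \<ge> length F"
    using that by (auto simp: syzygies_def supp_le_def)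
  show "syzygies F s \<subseteq> syzygies F t" if "mon_le s t"
    using that supp_le_mono by (auto simp: syzygies_def)
  show "finite (mon_lcm ` Pow (set (map fst F)))" by simp
  define D where "D = {g \<in> set (map fst F). mon_le g t}"
  have fin: "finite D" by (simp add: D_def)
  have "mon_le (mon_lcm D) t" using mon_lcm_le_iff[OF fin] by (auto simp: D_def)
  moreover have "syzygies F t \<subseteq> syzygies F (mon_lcm D)"
  proof
    fix \<mu> assume \<mu>: "\<mu> \<in> syzygies F t"
    have "mon_le (fst (F ! b)) (mon_lcm D)" if "b < length F" "mon_le (fst (F ! b)) t" for b
      using that mon_lcm_le_iff[OF fin, of "mon_lcm D"] by (auto simp: D_def)
    with \<mu> show "\<mu> \<in> syzygies F (mon_lcm D)" by (auto simp: syzygies_def supp_le_def)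
  qed
  ultimately show "\<exists>s\<in>mon_lcm ` Pow (set (map fst F)). mon_le s t \<and> syzygies F t \<subseteq> syzygies F s"
    by (intro bexI[of _ "mon_lcm D"]) (auto simp: D_def)
qed

section \<open>Existence of a minimal resolution\<close>

text \<open>
  The multigraded pieces of \<open>M\<close>, as a submodule of the free module of rank one.
\<close>
definition ideal_space :: "('n::finite, 'k::field) mpol set \<Rightarrow> 'n mon \<Rightarrow> (nat \<Rightarrow> 'k) set" where
  "ideal_space M t = {v. \<forall>a. v a \<noteq> 0 \<longrightarrow> a = 0 \<and> t \<in> mons M}"

lemma ideal_space_filtered:
  fixes M :: "('n::finite, 'k::field) mpol set"
  assumes M: "monomial_ideal M"
  shows "filtered_space (ideal_space M) 1 (insert 0 (min_gens M))"
proof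
  fix s t :: "'n mon" and v w :: "nat \<Rightarrow> 'k" and c :: 'k and a :: nat
  show "(\<lambda>_. 0) \<in> ideal_space M t" by (simp add: ideal_space_def)
  show "(\<lambda>a. v a + w a) \<in> ideal_space M t" if "v \<in> ideal_space M t" "w \<in> ideal_space M t"
    using that by (auto simp: ideal_space_def) (metis add.right_neutral)+
  show "(\<lambda>a. c * v a) \<in> ideal_space M t" if "v \<in> ideal_space M t"
    using that by (auto simp: ideal_space_def)
  show "v a = 0" if "v \<in> ideal_space M t" "a \<ge> 1"
    using that by (auto simp: ideal_space_def)
  show "ideal_space M s \<subseteq> ideal_space M t" if "mon_le s t"
    using that mons_upward[OF M] by (auto simp: ideal_space_def)
  show "finite (insert 0 (min_gens M))" using finite_min_gens[OF M] by simp
  show "\<exists>s\<in>insert 0 (min_gens M). mon_le s t \<and> ideal_space M t \<subseteq> ideal_space M s"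
  proof (cases "t \<in> mons M")
    case True
    then obtain g where "g \<in> min_gens M" "mon_le g t" using mons_iff_min_gens[OF M] by blast
    with min_gens_subset[OF M] show ?thesis by (auto simp: ideal_space_def)
  next
    case False
    then show ?thesis by (auto simp: ideal_space_def)
  qed
qed

text \<open>
  The scalar vector that represents the component of \<open>v\<close> in multidegree \<open>t\<close>.
\<close>
definition mdegree_part :: "('n, 'k::field) family \<Rightarrow> 'n mon \<Rightarrow> (nat \<Rightarrow> ('n, 'k) mpol) \<Rightarrow> nat \<Rightarrow> 'k" where
  "mdegree_part F t v = (\<lambda>b. if b < length F \<and> mon_le (fst (F ! b)) t
     then Poly_Mapping.lookup (v b) (t - fst (F ! b)) else 0)"

definition family_mat :: "('n, 'k::field) family \<Rightarrow> ('n, 'k) family \<Rightarrow> ('n, 'k) mpol mat" where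
  "family_mat F F' = mat (length F) (length F')
     (\<lambda>(a, b). Poly_Mapping.single (fst (F' ! b) - fst (F ! a)) (snd (F' ! b) a))"

lemma supp_le_mdegree_part: "supp_le F t (mdegree_part F t v)"
  by (simp add: supp_le_def mdegree_part_def)

lemma mdegree_part_eqD:
  assumes "\<And>t. mdegree_part F t v = mdegree_part F t w" "a < length F"
  shows "v a = w a"
proof (rule poly_mapping_eqI)
  fix s
  have "mdegree_part F (s + fst (F ! a)) v a = mdegree_part F (s + fst (F ! a)) w a" using assms(1) by simp
  then show "Poly_Mapping.lookup (v a) s = Poly_Mapping.lookup (w a) s"
    using assms(2) by (simp add: mdegree_part_def)
qed

lemma mdegree_part_cong: "(\<And>a. a < length F \<Longrightarrow> v a = w a) \<Longrightarrow> mdegree_part F t v = mdegree_part F t w"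
  by (auto simp: mdegree_part_def)

lemma mdegree_part_zero: "mdegree_part F t (\<lambda>_. 0) = (\<lambda>_. 0)"
  by (auto simp: mdegree_part_def)

lemma finite_mdegree_parts: "finite {t. mdegree_part F t v \<noteq> (\<lambda>_. 0)}"
proof (rule finite_subset)
  show "{t. mdegree_part F t v \<noteq> (\<lambda>_. 0)} \<subseteq>
      (\<Union>b<length F. (\<lambda>s. s + fst (F ! b)) ` Poly_Mapping.keys (v b))"
  proof
    fix t assume "t \<in> {t. mdegree_part F t v \<noteq> (\<lambda>_. 0)}"
    then obtain b where b: "mdegree_part F t v b \<noteq> 0" by auto
    then have "b < length F" "mon_le (fst (F ! b)) t" "t - fst (F ! b) \<in> Poly_Mapping.keys (v b)"
      by (auto simp: mdegree_part_def in_keys_iff split: if_splits)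
    then show "t \<in> (\<Union>b<length F. (\<lambda>s. s + fst (F ! b)) ` Poly_Mapping.keys (v b))"
      by (intro UN_I[of b] image_eqI[of _ _ "t - fst (F ! b)"]) (simp_all add: mon_le_diff_add)
  qed
qed simp

lemma diff_shift:
  assumes "mon_le g h" "mon_le g t"
  shows "mon_le (h - g) (t - g) \<longleftrightarrow> mon_le h t" "t - g - (h - g) = (t - h :: 'n mon)"
proof -
  obtain h' t' where "h = g + h'" "t = g + t'" using assms mon_le_iff_ex by blast
  then show "mon_le (h - g) (t - g) \<longleftrightarrow> mon_le h t" "t - g - (h - g) = t - h"
    by (simp_all add: mon_le_def lookup_add)
qed

text \<open>
  On multigraded pieces the polynomial matrix acts as the scalar matrix, whatever the multidegree.
\<close>
lemma mdegree_part_family_mat: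
  fixes F F' :: "('n, 'k::field) family"
  assumes supp: "\<And>b. b < length F' \<Longrightarrow> supp_le F (fst (F' ! b)) (snd (F' ! b))"
  shows "mdegree_part F t (mat_app (family_mat F F') w) = comb F' (mdegree_part F' t w)"
proof
  fix a
  show "mdegree_part F t (mat_app (family_mat F F') w) a = comb F' (mdegree_part F' t w) a"
  proof (cases "a < length F \<and> mon_le (fst (F ! a)) t")
    case True
    let ?g = "fst (F ! a)"
    have "Poly_Mapping.lookup (family_mat F F' $$ (a, b) * w b) (t - ?g) = mdegree_part F' t w b * snd (F' ! b) a"
      if b: "b < length F'" for b
    proof (cases "snd (F' ! b) a = 0")
      case False
      then have le: "mon_le ?g (fst (F' ! b))" using supp[OF b] by (simp add: supp_le_def)
      show ?thesis
        using True b diff_shift[OF le, of t]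
        by (simp add: family_mat_def lookup_single_mult mdegree_part_def)
    qed (use True b in \<open>simp add: family_mat_def\<close>)
    then show ?thesis
      using True by (simp add: mdegree_part_def[of F] mat_app_def lookup_sum comb_def) (simp add: family_mat_def)
  next
    case False
    have "mdegree_part F' t w b * snd (F' ! b) a = 0" if b: "b < length F'" for b
    proof (rule ccontr)
      assume "mdegree_part F' t w b * snd (F' ! b) a \<noteq> 0"
      then have "mon_le (fst (F' ! b)) t" "snd (F' ! b) a \<noteq> 0"
        by (auto simp: mdegree_part_def split: if_splits)
      then show False using False supp[OF b] mon_le_trans unfolding supp_le_def by blast
    qed
    then have "comb F' (mdegree_part F' t w) a = 0" unfolding comb_def by (intro sum.neutral) auto
    with False show ?thesis by (auto simp: mdegree_part_def)
  qed
qed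

text \<open>
  The image is determined piece by piece. A preimage is assembled from preimages of
  the pieces; choosing 0 for the pieces that vanish keeps it polynomial.
\<close>
lemma image_family_mat_iff:
  fixes F F' :: "('n, 'k::field) family"
  assumes gen: "min_generates F' K" and K: "filtered_space K m B"
    and supp: "\<And>t v. v \<in> K t \<Longrightarrow> supp_le F t v"
  shows "(\<exists>w. \<forall>a<length F. v a = mat_app (family_mat F F') w a) \<longleftrightarrow> (\<forall>t. mdegree_part F t v \<in> K t)"
proof -
  interpret filtered_space K m B by (rule K)
  have mem: "snd (F' ! b) \<in> K (fst (F' ! b))" if "b < length F'" for b
    using gen that by (simp add: min_generates_def)
  have part_app: "mdegree_part F t (mat_app (family_mat F F') w) = comb F' (mdegree_part F' t w)" for t w
    by (rule mdegree_part_family_mat) (rule supp[OF mem])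
  show ?thesis
  proof
    assume "\<exists>w. \<forall>a<length F. v a = mat_app (family_mat F F') w a"
    then obtain w where w: "\<And>a. a < length F \<Longrightarrow> v a = mat_app (family_mat F F') w a" by blast
    show "\<forall>t. mdegree_part F t v \<in> K t"
    proof
      fix t
      have "mdegree_part F t v = comb F' (mdegree_part F' t w)"
        using mdegree_part_cong[OF w] part_app by simp
      also have "\<dots> \<in> K t"
        unfolding comb_def
        by (rule sum_mem) (use mem mono in \<open>auto simp: mdegree_part_def split: if_splits\<close>)
      finally show "mdegree_part F t v \<in> K t" .
    qed
  next
    assume v: "\<forall>t. mdegree_part F t v \<in> K t"
    have "\<exists>\<mu>. supp_le F' t \<mu> \<and> mdegree_part F t v = comb F' \<mu> \<and> (mdegree_part F t v = (\<lambda>_. 0) \<longrightarrow> \<mu> = (\<lambda>_. 0))" for t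
    proof (cases "mdegree_part F t v = (\<lambda>_. 0)")
      case True
      then show ?thesis by (intro exI[of _ "\<lambda>_. 0"]) (simp add: comb_zero supp_le_def)
    next
      case False
      then show ?thesis using gen v unfolding min_generates_def by blast
    qed
    then obtain \<mu> where \<mu>: "\<And>t. supp_le F' t (\<mu> t)" "\<And>t. mdegree_part F t v = comb F' (\<mu> t)"
      "\<And>t. mdegree_part F t v = (\<lambda>_. 0) \<Longrightarrow> \<mu> t = (\<lambda>_. 0)" by metis
    define w where "w b = Poly_Mapping.Abs_poly_mapping (\<lambda>s. \<mu> (s + fst (F' ! b)) b)" for b
    have w: "Poly_Mapping.lookup (w b) s = \<mu> (s + fst (F' ! b)) b" for b s
    proof -
      let ?h = "\<lambda>s. s + fst (F' ! b)"
      have "finite (?h -` {t. mdegree_part F t v \<noteq> (\<lambda>_. 0)})"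
        by (rule finite_vimageI[OF finite_mdegree_parts]) (simp add: inj_def)
      then have "finite {s. \<mu> (?h s) b \<noteq> 0}"
        by (rule finite_subset[rotated]) (use \<mu>(3) in fastforce)
      then show ?thesis unfolding w_def by (simp add: lookup_Abs_poly_mapping)
    qed
    have "mdegree_part F' t w = \<mu> t" for t
      using \<mu>(1)[of t] by (auto simp: mdegree_part_def fun_eq_iff w mon_le_diff_add supp_le_def)
    then have "mdegree_part F t v = mdegree_part F t (mat_app (family_mat F F') w)" for t
      by (simp add: part_app \<mu>(2))
    then show "\<exists>w. \<forall>a<length F. v a = mat_app (family_mat F F') w a"
      using mdegree_part_eqD by blast
  qed
qed

context
  fixes M :: "('n::finite, 'k::field) mpol set"
  assumes M: "monomial_ideal M"
begin

text \<open>
  The submodule that the differential \<open>i\<close> has to cover: the ideal \<open>M\<close> inside \<open>S\<close> for \<open>i = 0\<close>, the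
  kernel of the preceding differential afterwards.
\<close>
primrec relation_space :: "nat \<Rightarrow> 'n mon \<Rightarrow> (nat \<Rightarrow> 'k) set" where
  "relation_space 0 = ideal_space M"
| "relation_space (Suc i) = syzygies (SOME F. min_generates F (relation_space i))"

text \<open>
  The multidegrees of the \<open>i\<close>-th free module with the columns of the differential leaving it. The
  0-th module is \<open>S\<close>; no differential leaves it, so its column is a dummy.
\<close>
definition res_family :: "nat \<Rightarrow> ('n, 'k) family" where
  "res_family i = (case i of 0 \<Rightarrow> [(0, \<lambda>_. 0)] | Suc i \<Rightarrow> SOME F. min_generates F (relation_space i))"

lemma relation_space_Suc: "relation_space (Suc i) = syzygies (res_family (Suc i))"
  by (simp add: res_family_def)

lemma relation_space_filtered: "\<exists>m B. filtered_space (relation_space i) m B"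
proof (cases i)
  case 0
  then show ?thesis using ideal_space_filtered[OF M] by auto
next
  case (Suc k)
  then show ?thesis using syzygies_filtered by (auto simp only: relation_space_Suc)
qed

lemma res_family_generates: "min_generates (res_family (Suc i)) (relation_space i)"
proof -
  have "\<exists>F. min_generates F (relation_space i)"
    using relation_space_filtered[of i] filtered_space.exists_min_generates by blast
  then show ?thesis unfolding res_family_def nat.case by (rule someI_ex)
qed

lemma supp_le_relation_space: "v \<in> relation_space i t \<Longrightarrow> supp_le (res_family i) t v"
proof (cases i)
  case 0
  then show "v \<in> relation_space i t \<Longrightarrow> ?thesis"
    by (auto simp: ideal_space_def supp_le_def res_family_def)
next
  case (Suc k)
  then show "v \<in> relation_space i t \<Longrightarrow> ?thesis"
    by (auto simp only: relation_space_Suc syzygies_def)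
qed

abbreviation res_mat :: "nat \<Rightarrow> ('n, 'k) mpol mat" where
  "res_mat i \<equiv> family_mat (res_family i) (res_family (Suc i))"

lemma image_res_mat:
  "(\<exists>w. \<forall>a<length (res_family i). v a = mat_app (res_mat i) w a) \<longleftrightarrow>
    (\<forall>t. mdegree_part (res_family i) t v \<in> relation_space i t)"
  using relation_space_filtered[of i] image_family_mat_iff[OF res_family_generates _ supp_le_relation_space]
  by blast

lemma supp_le_column:
  "b < length (res_family (Suc i)) \<Longrightarrow>
    supp_le (res_family i) (fst (res_family (Suc i) ! b)) (snd (res_family (Suc i) ! b))"
  using res_family_generates[of i] supp_le_relation_space by (auto simp: min_generates_def)

lemma kernel_res_mat:
  "(\<forall>a<length (res_family i). mat_app (res_mat i) v a = 0) \<longleftrightarrow>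
    (\<forall>t. mdegree_part (res_family (Suc i)) t v \<in> relation_space (Suc i) t)"
proof -
  let ?F = "res_family i" and ?F' = "res_family (Suc i)"
  have "(\<forall>a<length ?F. mat_app (res_mat i) v a = 0) \<longleftrightarrow>
      (\<forall>t. mdegree_part ?F t (mat_app (res_mat i) v) = (\<lambda>_. 0))"
  proof
    assume "\<forall>a<length ?F. mat_app (res_mat i) v a = 0"
    then show "\<forall>t. mdegree_part ?F t (mat_app (res_mat i) v) = (\<lambda>_. 0)"
      using mdegree_part_cong[of ?F "mat_app (res_mat i) v" "\<lambda>_. 0"] mdegree_part_zero by metis
  next
    assume "\<forall>t. mdegree_part ?F t (mat_app (res_mat i) v) = (\<lambda>_. 0)"
    then show "\<forall>a<length ?F. mat_app (res_mat i) v a = 0"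
      using mdegree_part_eqD[of ?F "mat_app (res_mat i) v" "\<lambda>_. 0"] by (simp add: mdegree_part_zero)
  qed
  also have "\<dots> \<longleftrightarrow> (\<forall>t. mdegree_part ?F' t v \<in> relation_space (Suc i) t)"
    by (simp only: mdegree_part_family_mat[OF supp_le_column] relation_space_Suc syzygies_def mem_Collect_eq
        supp_le_mdegree_part simp_thms)
  finally show ?thesis .
qed

lemma res_mat_carrier: "res_mat i \<in> carrier_mat (length (res_family i)) (length (res_family (Suc i)))"
  by (simp add: family_mat_def)

definition res_degs :: "nat \<Rightarrow> int list" where
  "res_degs i = map (\<lambda>p. int (mdeg (fst p))) (res_family i)"

lemma res_mat_graded: "graded_map (res_degs i) (res_degs (Suc i)) (res_mat i)"
  unfolding graded_map_def
proof (intro conjI allI impI)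
  show "res_mat i \<in> carrier_mat (length (res_degs i)) (length (res_degs (Suc i)))"
    by (simp add: res_degs_def res_mat_carrier)
  fix a b assume a: "a < length (res_degs i)" and b: "b < length (res_degs (Suc i))"
  let ?h = "fst (res_family (Suc i) ! b)" and ?g = "fst (res_family i ! a)"
  have le: "mon_le ?g ?h" if "snd (res_family (Suc i) ! b) a \<noteq> 0"
    using supp_le_column[of b i] b that by (simp add: res_degs_def supp_le_def)
  show "homogeneous (res_mat i $$ (a, b)) (res_degs (Suc i) ! b - res_degs i ! a)"
    using a b mdeg_diff[OF le] by (simp add: family_mat_def res_degs_def homogeneous_def)
qed

text \<open>
  A nonzero constant entry forces equal multidegrees of its row and column. For \<open>i > 0\<close> the column
  then is a relation in the multidegree of the generator indexed by the row, with nonzero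
  coefficient at that generator, contrary to minimality of the preceding choice. For \<open>i = 0\<close> it makes
  \<open>1\<close> an element of \<open>M\<close>.
\<close>
lemma res_mat_minimal:
  assumes proper: "0 \<notin> mons M" and a: "a < length (res_family i)" and b: "b < length (res_family (Suc i))"
  shows "Poly_Mapping.lookup (res_mat i $$ (a, b)) 0 = 0"
proof (rule ccontr)
  let ?h = "fst (res_family (Suc i) ! b)" and ?g = "fst (res_family i ! a)"
    and ?v = "snd (res_family (Suc i) ! b)"
  assume "Poly_Mapping.lookup (res_mat i $$ (a, b)) 0 \<noteq> 0"
  then have nz: "?v a \<noteq> 0" and "?h - ?g = 0"
    using a b by (auto simp: family_mat_def lookup_single when_def split: if_splits)
  moreover have "mon_le ?g ?h" using supp_le_column[OF b] nz by (simp add: supp_le_def)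
  ultimately have eq: "?h = ?g" using mon_le_diff_add by fastforce
  have v: "?v \<in> relation_space i ?h" using res_family_generates[of i] b by (simp add: min_generates_def)
  show False
  proof (cases i)
    case 0
    then have "?g = 0" using a by (simp add: res_family_def)
    with v nz eq 0 proper show False by (auto simp: ideal_space_def)
  next
    case (Suc k)
    have "supp_le (res_family i) ?g ?v" "comb (res_family i) ?v = (\<lambda>_. 0)"
      using v unfolding eq unfolding Suc relation_space_Suc by (auto simp: syzygies_def)
    then have "?v a = 0" using res_family_generates[of k] a
      unfolding min_generates_def Suc by blast
    with nz show False by contradiction
  qed
qed

lemma exists_resolution_of_proper:
  assumes proper: "0 \<notin> mons M"
  shows "minimal_graded_free_resolution M res_degs (vec 1 (\<lambda>_. 1)) res_mat"
proof -
  have len: "length (res_degs i) = length (res_family i)" for i by (simp add: res_degs_def)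
  have f0: "res_family 0 = [(0, \<lambda>_. 0)]" by (simp add: res_family_def)
  have d0: "res_degs 0 = [0]" by (simp add: res_degs_def f0)
  have e: "vec (Suc 0) (\<lambda>_. 1) \<bullet> vec (Suc 0) v = v 0" for v :: "nat \<Rightarrow> ('n, 'k) mpol"
    by (simp add: scalar_prod_def)
  have sub: "A = C" if "A \<subseteq> carrier_vec m" "C \<subseteq> carrier_vec m" "\<And>v. vec m v \<in> A \<longleftrightarrow> vec m v \<in> C"
    for A C :: "('n, 'k) mpol vec set" and m
  proof -
    have "v \<in> A \<longleftrightarrow> v \<in> C" for v
    proof (cases "v \<in> carrier_vec m")
      case True
      with that(3)[of "vec_index v"] show ?thesis by (simp add: vec_vec_index)
    qed (use that in auto)
    then show ?thesis by blast
  qed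
  have img: "mat_image (res_mat i) \<subseteq> carrier_vec (length (res_family i))" for i
    using res_mat_carrier[of i] by (auto simp: mat_image_def)
  have aug: "{v \<in> carrier_vec 1. vec 1 (\<lambda>_. 1) \<bullet> v \<in> M} = mat_image (res_mat 0)"
  proof (rule sub[of _ 1])
    show "mat_image (res_mat 0) \<subseteq> carrier_vec 1" using img[of 0] by (simp add: f0)
    fix v :: "nat \<Rightarrow> ('n, 'k) mpol"
    have "vec 1 v \<in> mat_image (res_mat 0) \<longleftrightarrow> (\<forall>t. mdegree_part (res_family 0) t v \<in> relation_space 0 t)"
      using mat_image_iff[OF res_mat_carrier[of 0], of v] image_res_mat[of 0 v] by (simp add: f0)
    also have "\<dots> \<longleftrightarrow> v 0 \<in> M"
      unfolding in_monomial_ideal_iff[OF M]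
      by (auto simp: f0 mdegree_part_def ideal_space_def in_keys_iff split: if_splits)
    finally show "vec 1 v \<in> {v \<in> carrier_vec 1. vec 1 (\<lambda>_. 1) \<bullet> v \<in> M} \<longleftrightarrow>
        vec 1 v \<in> mat_image (res_mat 0)"
      by (simp add: e)
  qed auto
  have exact: "mat_kernel (res_mat i) = mat_image (res_mat (Suc i))" for i
  proof (rule sub[of _ "length (res_family (Suc i))"])
    show "mat_kernel (res_mat i) \<subseteq> carrier_vec (length (res_family (Suc i)))"
      using res_mat_carrier[of i] by (auto simp: mat_kernel_def)
    show "mat_image (res_mat (Suc i)) \<subseteq> carrier_vec (length (res_family (Suc i)))" by (rule img)
    show "vec (length (res_family (Suc i))) v \<in> mat_kernel (res_mat i) \<longleftrightarrow>
        vec (length (res_family (Suc i))) v \<in> mat_image (res_mat (Suc i))" for v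
      unfolding mat_kernel_iff[OF res_mat_carrier] mat_image_iff[OF res_mat_carrier]
        kernel_res_mat image_res_mat ..
  qed
  show ?thesis
    unfolding minimal_graded_free_resolution_def
  proof (intro conjI allI impI)
    show "vec 1 (\<lambda>_. 1) \<in> carrier_vec (length (res_degs 0))" by (simp add: d0)
    show "homogeneous (vec 1 (\<lambda>_. 1) $ b :: ('n, 'k) mpol) (res_degs 0 ! b)" if "b < length (res_degs 0)" for b
      using that by (simp add: d0 homogeneous_def)
    show "graded_map (res_degs i) (res_degs (Suc i)) (res_mat i)" for i by (rule res_mat_graded)
    show "\<exists>v\<in>carrier_vec (length (res_degs 0)). f - vec 1 (\<lambda>_. 1) \<bullet> v \<in> M" for f
      by (rule bexI[of _ "vec 1 (\<lambda>_. f)"]) (auto simp: d0 e ideal_zero[OF M])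
    show "{v \<in> carrier_vec (length (res_degs 0)). vec 1 (\<lambda>_. 1) \<bullet> v \<in> M} = mat_image (res_mat 0)"
      using aug by (simp add: d0)
    show "mat_kernel (res_mat i) = mat_image (res_mat (Suc i))" for i by (rule exact)
    show "Poly_Mapping.lookup (res_mat i $$ (a, b)) 0 = 0"
      if "a < length (res_degs i)" "b < length (res_degs (Suc i))" for i a b
      using res_mat_minimal[OF proper] that by (simp add: len)
  qed
qed

text \<open>
  For \<open>M = S\<close> the free module \<open>F\<^sub>0\<close> of a minimal resolution has to be zero, so this case is
  separate from the construction above.
\<close>
lemma exists_minimal_resolution: "\<exists>degs e d. minimal_graded_free_resolution M degs e d"
proof (cases "0 \<in> mons M")
  case True
  then have "f \<in> M" for f
    using in_monomial_ideal_iff[OF M] mons_upward[OF M] mon_le_zero by blast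
  moreover have "{v. v \<in> carrier_vec 0} = mat_image (0\<^sub>m 0 0 :: ('n, 'k) mpol mat)"
    "mat_kernel (0\<^sub>m 0 0) = mat_image (0\<^sub>m 0 0 :: ('n, 'k) mpol mat)"
    by (auto simp: mat_image_def mat_kernel_def intro!: exI[of _ "vec 0 (\<lambda>_. 0)"] eq_vecI mult_mat_vec_carrier[of _ 0 0])
  ultimately have "minimal_graded_free_resolution M (\<lambda>_. []) (vec 0 (\<lambda>_. 0)) (\<lambda>_. 0\<^sub>m 0 0)"
    by (auto simp: minimal_graded_free_resolution_def graded_map_def intro!: exI[of _ "vec 0 (\<lambda>_. 0)"])
  then show ?thesis by blast
next
  case False
  then show ?thesis using exists_resolution_of_proper by blast
qed

end

theorem corollary6p3:
  fixes M :: "('n::finite, 'k::field) mpol set"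
  assumes "monomial_ideal M"
  shows "betti CARD('n) M = card (lcm_set M) \<and>
    (\<forall>j::nat. graded_betti CARD('n) (int j) M = card {l \<in> lcm_set M. mdeg l = j})"
proof -
  have inj: "inj_on (\<lambda>t :: 'n mon. t + ones) S" for S by (simp add: inj_on_def)
  have total: "length (degs CARD('n)) = card (lcm_set M)"
    if "minimal_graded_free_resolution M degs e d" for degs e d
  proof -
    interpret resolution M degs e d using assms that by unfold_locales
    show ?thesis unfolding lcm_set_eq[OF assms] card_image[OF inj] by (rule top_rank)
  qed
  have graded: "count_list (degs CARD('n)) (int j) = card {l \<in> lcm_set M. mdeg l = j}"
    if "minimal_graded_free_resolution M degs e d" for degs e d and j :: nat
  proof -
    interpret resolution M degs e d using assms that by unfold_locales
    have "{t \<in> socle_mons M. mdeg t + CARD('n) = j} =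
        {t \<in> socle_mons M. int (mdeg t) + int CARD('n) = int j}" by auto
    then show ?thesis
      unfolding lcm_set_degree_eq[OF assms] card_image[OF inj] by (simp add: top_degrees(2))
  qed
  obtain degs e d where res: "minimal_graded_free_resolution M degs e d"
    using exists_minimal_resolution[OF assms] by blast
  have "betti CARD('n) M = card (lcm_set M)"
    unfolding betti_def
  proof (rule the_equality)
    show "\<exists>degs e d. minimal_graded_free_resolution M degs e d \<and>
        card (lcm_set M) = length (degs CARD('n))"
      using total[OF res] res by (intro exI[of _ degs] exI[of _ e] exI[of _ d]) simp
    show "b = card (lcm_set M)"
      if "\<exists>degs e d. minimal_graded_free_resolution M degs e d \<and> b = length (degs CARD('n))" for b
      using that total by (elim exE conjE) simp
  qed
  moreover have "graded_betti CARD('n) (int j) M = card {l \<in> lcm_set M. mdeg l = j}" for j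
    unfolding graded_betti_def
  proof (rule the_equality)
    show "\<exists>degs e d. minimal_graded_free_resolution M degs e d \<and>
        card {l \<in> lcm_set M. mdeg l = j} = count_list (degs CARD('n)) (int j)"
      using graded[OF res] res by (intro exI[of _ degs] exI[of _ e] exI[of _ d]) simp
    show "b = card {l \<in> lcm_set M. mdeg l = j}"
      if "\<exists>degs e d. minimal_graded_free_resolution M degs e d \<and>
        b = count_list (degs CARD('n)) (int j)" for b
      using that graded by (elim exE conjE) simp
  qed
  ultimately show ?thesis by blast
qed

end
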